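(* Let $\alpha,\nu,\theta,I>0$. For any $\mathcal{M}>0$ and any $K\in W^{1,p}(\mathbb{R})$ with $p\in[1,\infty]$, there exists a stationary solution $f^\infty$ of the nonlinear Vlasov-Fokker-Planck equation (see context) with mass $\mathcal{M}$, of the form $$f^\infty(x,v)=\frac{\mathcal{M}}{\sqrt{2\pi\theta}}\,e^{-\frac{v^2}{2\theta}}\,\sigma^\infty(x),$$ where $\sigma^\infty$ is a fixed point of the mapping $$\mathcal{T}(\sigma)(x):=\frac{e^{-\frac{\alpha x^2}{2\theta}-\frac{I\mathcal{M}}{\theta}K\ast\sigma(x)}}{\int_{\mathbb{R}}e^{-\frac{\alpha y^2}{2\theta}-\frac{I\mathcal{M}}{\theta}K\ast\sigma(y)}\,\mathrm{d}y},$$ which is such that $\sup_{x\in\mathbb{R}}\left|\partial_x^n\sigma^\infty(x)\,e^{\frac{\beta x^2}{2}}\right|<\infty$ for any $0<\beta<\alpha/\theta$ and $n\in\mathbb{N}$. Moreover, for any $K\in L^\infty(\mathbb{R})$, there is $C>0$ such that if $$I<I^{\mathrm{thres}}:=\frac{C\,\theta}{\mathcal{M}\,\|K\|_{L^\infty}},$$ then there is a unique integrable stationary solution of the form $\frac{\mathcal{M}}{\sqrt{2\pi\theta}}e^{-\frac{v^2}{2\theta}}\sigma^\infty(x)$.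
   Context: The nonlinear Vlasov-Fokker-Planck equation for $f=f(t,x,v)$, $(x,v)\in\mathbb{R}^2$, is $$\partial_tf+v\,\partial_xf+(F_f(t,x)-\alpha x)\,\partial_vf=2\nu\,\partial_v(vf+\theta\,\partial_vf),\qquad F_f(t,x)=-I\,\partial_xK\ast\rho(t,x),\qquad \rho(t,x)=\int_{\mathbb{R}}f(t,x,v)\,\mathrm{d}v,$$ where $\ast$ is convolution in $x$. The kernel $K$ is a function on $\mathbb{R}$ not assumed to be even. The mass of $f^\infty$ is $\iint_{\mathbb{R}^2}f^\infty\,\mathrm{d}x\,\mathrm{d}v$, so $\sigma^\infty$ is normalized by $\int_{\mathbb{R}}\sigma^\infty\,\mathrm{d}x=1$. For stationary solutions of the displayed product form, $\sigma^\infty$ being a solution is understood as $\sigma^\infty=\mathcal{T}(\sigma^\infty)$. *)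

theory Defs
  imports "HOL-Probability.Essential_Supremum"
begin

section \<open>Lebesgue and Sobolev spaces on the line\<close>

text \<open>Elements of \<open>L\<^sup>p(\<real>)\<close> are given by Borel representatives; everything below that takes a kernel
  depends only on its class modulo null sets.\<close>

definition Linf_norm :: "(real \<Rightarrow> real) \<Rightarrow> ereal" where
  "Linf_norm g = esssup lborel (\<lambda>x. ereal \<bar>g x\<bar>)"

definition Lp :: "ennreal \<Rightarrow> (real \<Rightarrow> real) \<Rightarrow> bool" where
  "Lp p g \<longleftrightarrow> g \<in> borel_measurable lborel \<and>
     (if p = \<infinity> then Linf_norm g < \<infinity>
      else integrable lborel (\<lambda>x. \<bar>g x\<bar> powr enn2real p))"

definition smooth :: "(real \<Rightarrow> real) \<Rightarrow> bool" where
  "smooth g \<longleftrightarrow> (\<forall>n x. ((deriv ^^ n) g) field_differentiable at x)"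

definition test_function :: "(real \<Rightarrow> real) \<Rightarrow> bool" where
  "test_function \<phi> \<longleftrightarrow> smooth \<phi> \<and> compact (closure {x. \<phi> x \<noteq> 0})"

definition locally_integrable :: "(real \<Rightarrow> real) \<Rightarrow> bool" where
  "locally_integrable g \<longleftrightarrow> (\<forall>a b. set_integrable lborel {a..b} g)"

definition has_weak_derivative :: "(real \<Rightarrow> real) \<Rightarrow> (real \<Rightarrow> real) \<Rightarrow> bool" where
  "has_weak_derivative g g' \<longleftrightarrow> locally_integrable g \<and> locally_integrable g' \<and>
     (\<forall>\<phi>. test_function \<phi> \<longrightarrow>
        (LINT x|lborel. g x * deriv \<phi> x) = - (LINT x|lborel. g' x * \<phi> x))"

definition W1p :: "ennreal \<Rightarrow> (real \<Rightarrow> real) \<Rightarrow> bool" where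
  "W1p p g \<longleftrightarrow> Lp p g \<and> (\<exists>g'. Lp p g' \<and> has_weak_derivative g g')"

definition convolve :: "(real \<Rightarrow> real) \<Rightarrow> (real \<Rightarrow> real) \<Rightarrow> real \<Rightarrow> real" where
  "convolve g h x = (LINT y|lborel. g (x - y) * h y)"


section \<open>The nonlinear Vlasov-Fokker-Planck equation\<close>

definition spatial_density :: "(real \<Rightarrow> real \<Rightarrow> real) \<Rightarrow> real \<Rightarrow> real" where
  "spatial_density g x = (LINT v|lborel. g x v)"

definition mass :: "(real \<Rightarrow> real \<Rightarrow> real) \<Rightarrow> real" where
  "mass g = (LINT z|lborel. case_prod g z)"

text \<open>Classical solutions \<open>f t x v\<close>. The function \<open>K'\<close> is the weak derivative of the kernel, which
  is unique up to null sets, so that the force does not depend on its choice. The integrability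
  conditions say that the density and the convolution in the force are well defined.\<close>

definition vfp_solution ::
  "real \<Rightarrow> real \<Rightarrow> real \<Rightarrow> real \<Rightarrow> (real \<Rightarrow> real) \<Rightarrow> (real \<Rightarrow> real \<Rightarrow> real \<Rightarrow> real) \<Rightarrow> bool" where
  "vfp_solution \<alpha> \<nu> \<theta> I K f \<longleftrightarrow>
     (\<exists>K'. has_weak_derivative K K' \<and>
       (\<forall>t>0. \<forall>x v.
          integrable lborel (\<lambda>w. f t x w) \<and>
          integrable lborel (\<lambda>y. K' (x - y) * spatial_density (f t) y) \<and>
          (\<lambda>s. f s x v) field_differentiable at t \<and>
          (\<lambda>y. f t y v) field_differentiable at x \<and>
          (\<lambda>w. f t x w) field_differentiable at v \<and>
          deriv (\<lambda>w. f t x w) field_differentiable at v \<and>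
          (let F = - I * convolve K' (spatial_density (f t)) x in
             deriv (\<lambda>s. f s x v) t + v * deriv (\<lambda>y. f t y v) x
               + (F - \<alpha> * x) * deriv (\<lambda>w. f t x w) v
             = 2 * \<nu> * deriv (\<lambda>w. w * f t x w + \<theta> * deriv (\<lambda>u. f t x u) w) v)))"

definition vfp_stationary ::
  "real \<Rightarrow> real \<Rightarrow> real \<Rightarrow> real \<Rightarrow> (real \<Rightarrow> real) \<Rightarrow> (real \<Rightarrow> real \<Rightarrow> real) \<Rightarrow> bool" where
  "vfp_stationary \<alpha> \<nu> \<theta> I K f \<longleftrightarrow> vfp_solution \<alpha> \<nu> \<theta> I K (\<lambda>t. f)"


section \<open>Stationary solutions of product form\<close>

definition product_form :: "real \<Rightarrow> real \<Rightarrow> (real \<Rightarrow> real) \<Rightarrow> real \<Rightarrow> real \<Rightarrow> real" where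
  "product_form \<theta> M \<sigma> x v = M / sqrt (2 * pi * \<theta>) * exp (- (v\<^sup>2 / (2 * \<theta>))) * \<sigma> x"

definition vfp_map ::
  "real \<Rightarrow> real \<Rightarrow> real \<Rightarrow> real \<Rightarrow> (real \<Rightarrow> real) \<Rightarrow> (real \<Rightarrow> real) \<Rightarrow> real \<Rightarrow> real" where
  "vfp_map \<alpha> \<theta> I M K \<sigma> x =
     exp (- (\<alpha> * x\<^sup>2 / (2 * \<theta>)) - I * M / \<theta> * convolve K \<sigma> x) /
     (LINT y|lborel. exp (- (\<alpha> * y\<^sup>2 / (2 * \<theta>)) - I * M / \<theta> * convolve K \<sigma> y))"

text \<open>For kernels without a weak derivative, a product-form stationary solution is understood through
  the fixed-point equation. The equation is required pointwise: since \<open>vfp_map\<close> depends on \<open>\<sigma>\<close> only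
  up to null sets, every almost-everywhere fixed point has exactly one representative that is a
  pointwise fixed point, so uniqueness of functions here is uniqueness of \<open>L\<^sup>1\<close> classes.\<close>

definition product_stationary ::
  "real \<Rightarrow> real \<Rightarrow> real \<Rightarrow> real \<Rightarrow> (real \<Rightarrow> real) \<Rightarrow> (real \<Rightarrow> real \<Rightarrow> real) \<Rightarrow> bool" where
  "product_stationary \<alpha> \<theta> I M K f \<longleftrightarrow>
     (\<exists>\<sigma>. f = product_form \<theta> M \<sigma> \<and> \<sigma> = vfp_map \<alpha> \<theta> I M K \<sigma>)"

text \<open>In \<^typ>\<open>ereal\<close> the threshold is \<open>\<infinity>\<close> when \<open>K\<close> vanishes almost everywhere.\<close>

definition I_thres :: "real \<Rightarrow> real \<Rightarrow> real \<Rightarrow> (real \<Rightarrow> real) \<Rightarrow> ereal" where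
  "I_thres C \<theta> M K = ereal (C * \<theta>) / (ereal M * Linf_norm K)"

end

theory Submission
  imports Defs "HOL-Probability.Distributions" "HOL-Library.Diagonal_Subsequence"
begin

text \<open>
  A fixed point \<open>\<sigma>\<close> is the Gibbs density of the potential \<open>\<alpha> x\<^sup>2 / (2 \<theta>) + u\<close> with
  \<open>u = c (K * \<sigma>)\<close>, \<open>c = I M / \<theta>\<close>, so one looks for a fixed point of \<open>u \<mapsto> c (K * gibbs u)\<close> among bounded
  functions. A kernel in \<open>W\<^sup>1\<^sup>,\<^sup>p\<close> is bounded and its derivative is dominated by an integrable function
  plus a constant; hence all values of this map share a sup bound and a Lipschitz constant. Kuhn's
  combinatorial lemma gives approximate fixed points among step functions on a grid, and a diagonal
  subsequence converges to a fixed point. Smoothness and decay follow by bootstrapping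
  \<open>\<sigma>' = (- (\<alpha> / \<theta>) x - c (K' * \<sigma>)) \<sigma>\<close>. If two potentials differ by at most \<open>t\<close>, their Gibbs densities differ
  by at most \<open>exp (2 t) - 1\<close> in \<open>L\<^sup>1\<close>, so for \<open>c \<parallel>K\<parallel>\<^sub>\<infinity> \<le> 1 / 8\<close> the map is a contraction.
\<close>


section \<open>The class \<open>L\<^sup>1 + L\<^sup>\<infinity>\<close> and convolution\<close>

text \<open>The unknown is the potential rather than the density: admissible potentials fill a
  sup-norm ball, whose discretisations are cubes, and normalisation returns a probability density
  for each of them. The line is not compact, so only pointwise convergence of potentials can be
  expected. It suffices, because all Gibbs densities of the ball share one integrable majorant, a
  multiple of \<open>exp (- \<phi> x)\<close>; for the same reason the k-th grid need only cover
  \<open>[-k, k)\<close>. The common Lipschitz constant bridges the grid cells and yields the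
  convergent subsequence. The derivative \<open>K'\<close> may be as rough as a member of L1 + Linf.
  In the bootstrap every further derivative is therefore put on \<open>\<sigma>\<close>, and
  \<open>K' * \<sigma>\<close> is as smooth as \<open>\<sigma>\<close> itself. Since the weak
  derivative is only an identity against test functions, the kernel is first identified almost
  everywhere with a primitive of \<open>K'\<close>. A merely bounded kernel offers no Lipschitz
  constant, so below the threshold existence too comes from the contraction. Two potentials of size
  \<open>1 / 8\<close> differ by \<open>t \<le> 1 / 4\<close>; then
  \<open>exp (2 * t) - 1 \<le> 4 * t\<close>, and the factor \<open>1 / 8\<close> turns this into
  \<open>t / 2\<close>.\<close>

definition L1_plus_Linf :: "(real \<Rightarrow> real) \<Rightarrow> (real \<Rightarrow> real) \<Rightarrow> real \<Rightarrow> bool" where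
  "L1_plus_Linf h k B \<longleftrightarrow> h \<in> borel_measurable borel \<and> integrable lborel k \<and>
     (\<forall>x. 0 \<le> k x) \<and> 0 \<le> B \<and> (\<forall>x. \<bar>h x\<bar> \<le> k x + B)"

lemma Lp_infinity_AE_bounded:
  assumes "Lp \<infinity> h"
  shows "\<exists>B\<ge>0. Linf_norm h = ereal B \<and> (AE x in lborel. \<bar>h x\<bar> \<le> B)"
proof -
  have m: "h \<in> borel_measurable lborel" and fin: "Linf_norm h < \<infinity>"
    using assms by (auto simp: Lp_def)
  have ae: "AE x in lborel. ereal \<bar>h x\<bar> \<le> Linf_norm h"
    unfolding Linf_norm_def by (rule esssup_AE)
  have "0 = esssup lborel (\<lambda>x::real. 0::ereal)"
    by (rule esssup_const[symmetric]) simp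
  also have "\<dots> \<le> Linf_norm h"
    unfolding Linf_norm_def by (rule esssup_mono) (use m in auto)
  finally have "0 \<le> Linf_norm h" .
  with fin obtain B where B: "Linf_norm h = ereal B" "B \<ge> 0"
    by (cases "Linf_norm h") auto
  have "AE x in lborel. \<bar>h x\<bar> \<le> B" using ae unfolding B(1) by simp
  with B show ?thesis by blast
qed

text \<open>The class asks for domination at every point, so the excess of
  \<open>\<bar>h x\<bar>\<close> over \<open>B\<close> on the exceptional null set is moved into the
  integrable part, where it has integral zero.\<close>

lemma L1_plus_Linf_I_AE:
  assumes [measurable]: "h \<in> borel_measurable borel" and "0 \<le> B" "AE x in lborel. \<bar>h x\<bar> \<le> B"
  shows "L1_plus_Linf h (\<lambda>x. max 0 (\<bar>h x\<bar> - B)) B"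
proof -
  have "integrable lborel (\<lambda>x. max 0 (\<bar>h x\<bar> - B)) \<longleftrightarrow> integrable lborel (\<lambda>x::real. 0::real)"
    by (rule integrable_cong_AE) (use assms(3) in \<open>auto intro: AE_mp\<close>)
  then show ?thesis using assms unfolding L1_plus_Linf_def by auto
qed

text \<open>For a finite exponent \<open>r \<ge> 1\<close>, values of modulus at most 1 are absorbed
  by the constant and larger ones by \<open>\<bar>h x\<bar> powr r\<close>. All exponents are
  thereby reduced to a single class.\<close>

lemma Lp_imp_L1_plus_Linf:
  assumes "1 \<le> p" "Lp p h"
  shows "\<exists>k B. L1_plus_Linf h k B"
proof (cases "p = \<infinity>")
  case True
  with assms(2) Lp_infinity_AE_bounded[of h] obtain B
    where "B \<ge> 0" "AE x in lborel. \<bar>h x\<bar> \<le> B" by auto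
  then show ?thesis
    using L1_plus_Linf_I_AE[of h B] assms(2) by (auto simp: Lp_def)
next
  case False
  define r where "r = enn2real p"
  have r: "r \<ge> 1" using enn2real_mono[OF assms(1)] False unfolding r_def
    by (simp add: less_top)
  have "integrable lborel (\<lambda>x. \<bar>h x\<bar> powr r)" and [measurable]: "h \<in> borel_measurable borel"
    using assms(2) False by (auto simp: Lp_def r_def)
  moreover have "\<bar>h x\<bar> \<le> \<bar>h x\<bar> powr r + 1" for x
  proof (cases "\<bar>h x\<bar> \<le> 1")
    case False
    then have "\<bar>h x\<bar> powr 1 \<le> \<bar>h x\<bar> powr r" using r by (intro powr_mono) auto
    then show ?thesis using False by auto
  qed (auto intro: add_increasing)
  ultimately have "L1_plus_Linf h (\<lambda>x. \<bar>h x\<bar> powr r) 1"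
    unfolding L1_plus_Linf_def by auto
  then show ?thesis by blast
qed

section \<open>Reflections and the basic convolution estimate\<close>

lemma integrable_reflect_iff:
  "integrable lborel (\<lambda>y. f (x - y)) \<longleftrightarrow> integrable lborel f" for f :: "real \<Rightarrow> real"
  using lborel_integrable_real_affine_iff[of "-1" f x] by simp

lemma integral_reflect:
  "(LINT y|lborel. f (x - y)) = (LINT y|lborel. f y)" for f :: "real \<Rightarrow> real"
  using lborel_integral_real_affine[of "-1" f x] by simp

lemma AE_reflect:
  assumes "AE y in lborel. P y"
  shows "AE y in lborel. P (x - y :: real)"
proof -
  have eq: "distr lborel borel (\<lambda>y. x + - 1 * y) = (lborel :: real measure)"
    using lborel_real_affine[of "-1" x] by (simp add: density_1)
  have "AE y in distr lborel borel (\<lambda>y. x + - 1 * y). P y" unfolding eq by (rule assms)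
  then have "AE y in lborel. P (x + - 1 * y)"
    by (rule AE_distrD[rotated]) measurable
  then show ?thesis by simp
qed

lemma convolve_commute: "convolve g h x = convolve h g x"
  unfolding convolve_def
  using integral_reflect[of "\<lambda>y. g (x - y) * h y" x] by (simp add: mult.commute)

lemma convolve_measurable [measurable]:
  assumes [measurable]: "g \<in> borel_measurable borel" "h \<in> borel_measurable borel"
  shows "convolve g h \<in> borel_measurable borel"
  unfolding convolve_def by measurable

text \<open>The integrable part of \<open>h\<close> is paired with the sup bound of
  \<open>g\<close>, the constant part with the L1 norm of \<open>g\<close>. The bound does not
  depend on \<open>x\<close>; in its absolute form it later serves as the Fubini majorant.\<close>

lemma L1_plus_Linf_convolve:
  assumes h: "L1_plus_Linf h k B" and g: "integrable lborel g" "\<And>x. \<bar>g x\<bar> \<le> A"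
  shows "integrable lborel (\<lambda>y. h (x - y) * g y)"
    and "(LINT y|lborel. \<bar>h (x - y) * g y\<bar>) \<le> A * (LINT y|lborel. k y) + B * (LINT y|lborel. \<bar>g y\<bar>)"
    and "\<bar>convolve h g x\<bar> \<le> A * (LINT y|lborel. k y) + B * (LINT y|lborel. \<bar>g y\<bar>)"
proof -
  have [measurable]: "h \<in> borel_measurable borel" "g \<in> borel_measurable borel"
    and k: "integrable lborel k" "\<And>x. 0 \<le> k x" "0 \<le> B" "\<And>x. \<bar>h x\<bar> \<le> k x + B"
    using h g by (auto simp: L1_plus_Linf_def)
  have A: "0 \<le> A" using g(2)[of 0] by linarith
  have bd: "\<bar>h (x - y) * g y\<bar> \<le> A * k (x - y) + B * \<bar>g y\<bar>" for y
  proof -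
    have "\<bar>h (x - y) * g y\<bar> \<le> (k (x - y) + B) * \<bar>g y\<bar>"
      unfolding abs_mult using k by (intro mult_right_mono) auto
    also have "\<dots> \<le> k (x - y) * A + B * \<bar>g y\<bar>"
      using g(2)[of y] k(2)[of "x-y"] by (auto simp: distrib_right intro: mult_left_mono)
    finally show ?thesis by (simp add: mult.commute)
  qed
  have ik: "integrable lborel (\<lambda>y. k (x - y))" using k(1) by (simp add: integrable_reflect_iff)
  have I: "integrable lborel (\<lambda>y. A * k (x - y) + B * \<bar>g y\<bar>)"
    using ik g(1) by (intro Bochner_Integration.integrable_add integrable_mult_right) auto
  show int: "integrable lborel (\<lambda>y. h (x - y) * g y)"
    by (rule Bochner_Integration.integrable_bound[OF I])
       (use bd order_trans[OF bd abs_ge_self] in auto)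
  have "(LINT y|lborel. \<bar>h (x - y) * g y\<bar>) \<le> (LINT y|lborel. A * k (x - y) + B * \<bar>g y\<bar>)"
    using int I bd by (intro integral_mono) auto
  also have "\<dots> = A * (LINT y|lborel. k y) + B * (LINT y|lborel. \<bar>g y\<bar>)"
    using ik g(1) integral_reflect[of k x] by (subst Bochner_Integration.integral_add) auto
  finally show le: "(LINT y|lborel. \<bar>h (x - y) * g y\<bar>) \<le> A * (LINT y|lborel. k y) + B * (LINT y|lborel. \<bar>g y\<bar>)" .
  have "\<bar>convolve h g x\<bar> \<le> (LINT y|lborel. \<bar>h (x - y) * g y\<bar>)"
    unfolding convolve_def by (rule integral_abs_bound)
  with le show "\<bar>convolve h g x\<bar> \<le> A * (LINT y|lborel. k y) + B * (LINT y|lborel. \<bar>g y\<bar>)" by simp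
qed

text \<open>Fubini applied to \<open>q' (s - y) * p y\<close> on the strip over
  \<open>{a..x}\<close>. Increments replace derivatives because \<open>q'\<close> is only an
  integral density of \<open>q\<close> and need not be its derivative at any given point.\<close>

lemma convolve_increment:
  fixes p q q' :: "real \<Rightarrow> real"
  assumes [measurable]: "p \<in> borel_measurable borel" "q' \<in> borel_measurable borel"
    and q: "\<And>a x. a \<le> x \<Longrightarrow> q x - q a = (LINT s:{a..x}|lborel. q' s)"
    and int: "\<And>s. integrable lborel (\<lambda>y. q' (s - y) * p y)"
    and bd: "\<And>s. (LINT y|lborel. \<bar>q' (s - y) * p y\<bar>) \<le> C"
    and qint: "\<And>x. integrable lborel (\<lambda>y. q (x - y) * p y)"
    and ax: "a \<le> x"
  shows "convolve q p x - convolve q p a = (LINT s:{a..x}|lborel. convolve q' p s)"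
    and "set_integrable lborel {a..x} (convolve q' p)"
proof -
  let ?H = "\<lambda>s y. indicator {a..x} s * (q' (s - y) * p y) :: real"
  have C: "0 \<le> C" using order_trans[OF _ bd[of 0]] by simp
  have H: "integrable (lborel \<Otimes>\<^sub>M lborel) (\<lambda>(s, y). ?H s y)"
  proof (rule lborel_pair.Fubini_integrable)
    \<comment> \<open>Only \<open>s\<close> in \<open>{a..x}\<close> contributes, so the bound
      \<open>C\<close>, uniform in \<open>s\<close>, is an integrable majorant.\<close>
    show "integrable lborel (\<lambda>s. LINT y|lborel. norm (case (s, y) of (s, y) \<Rightarrow> ?H s y))"
    proof (rule Bochner_Integration.integrable_bound)
      show "integrable lborel (\<lambda>s. C * indicator {a..x} s)"
        by (intro integrable_mult_right integrable_real_indicator) (use ax in simp_all)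
      show "AE s in lborel. norm (LINT y|lborel. norm (case (s, y) of (s, y) \<Rightarrow> ?H s y))
              \<le> norm (C * indicator {a..x} s)"
        using bd C by (intro AE_I2) (auto simp: indicator_def)
    qed measurable
    show "AE s in lborel. integrable lborel (\<lambda>y. case (s, y) of (s, y) \<Rightarrow> ?H s y)"
      using int by simp
  qed measurable
  have inner: "(LINT s|lborel. ?H s y) = (q (x - y) - q (a - y)) * p y" for y
  proof -
    have "(LINT s|lborel. ?H s y) = (LINT s|lborel. indicator {a..x} s * q' (s - y)) * p y"
      by (subst integral_mult_left_zero[symmetric]) (simp add: mult.assoc)
    also have "(LINT s|lborel. indicator {a..x} s * q' (s - y))
        = (LINT s|lborel. indicator {a..x} (y + 1 * s) * q' ((y + 1 * s) - y))"
      using lborel_integral_real_affine[of 1 "\<lambda>s. indicator {a..x} s * q' (s - y)" y] by simp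
    also have "\<dots> = (LINT s:{a-y..x-y}|lborel. q' s)"
      unfolding set_lebesgue_integral_def
      by (intro Bochner_Integration.integral_cong) (auto simp: indicator_def)
    also have "\<dots> = q (x - y) - q (a - y)" using q[of "a-y" "x-y"] ax by simp
    finally show ?thesis .
  qed
  have "convolve q p x - convolve q p a = (LINT y|lborel. q (x - y) * p y - q (a - y) * p y)"
    unfolding convolve_def using qint by (subst Bochner_Integration.integral_diff) auto
  also have "\<dots> = (LINT y|lborel. LINT s|lborel. ?H s y)"
    unfolding inner by (simp add: algebra_simps)
  also have "\<dots> = (LINT s|lborel. LINT y|lborel. ?H s y)"
    by (rule lborel_pair.Fubini_integral) (use H in simp)
  also have "\<dots> = (LINT s:{a..x}|lborel. convolve q' p s)"
    unfolding set_lebesgue_integral_def convolve_def by simp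
  finally show "convolve q p x - convolve q p a = (LINT s:{a..x}|lborel. convolve q' p s)" .
  show "set_integrable lborel {a..x} (convolve q' p)"
    using lborel_pair.integrable_fst'[OF H] by (simp add: set_integrable_def convolve_def)
qed

text \<open>Near \<open>x\<close> the function is a constant plus the indefinite integral of a
  continuous function. The window from \<open>x - 1\<close> to \<open>x + 1\<close> has
  \<open>x\<close> in its interior, which removes the restriction from the derivative.\<close>

lemma integral_continuous_imp_derivative:
  fixes J J' :: "real \<Rightarrow> real"
  assumes J: "\<And>a x. a \<le> x \<Longrightarrow> J x - J a = (LINT s:{a..x}|lborel. J' s)"
    and cont: "continuous_on UNIV J'"
  shows "(J has_real_derivative J' x) (at x)"
proof -
  define a where "a = x - 1"
  define b where "b = x + 1"
  have cab: "continuous_on {a..b} J'" using cont by (rule continuous_on_subset) simp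
  have "((\<lambda>u. integral {a..u} J') has_real_derivative J' x) (at x within {a..b})"
    by (rule integral_has_real_derivative[OF cab]) (auto simp: a_def b_def)
  then have "((\<lambda>u. J a + integral {a..u} J') has_real_derivative J' x) (at x within {a..b})"
    by (auto intro!: derivative_eq_intros)
  then have "(J has_real_derivative J' x) (at x within {a..b})"
  proof (rule has_field_derivative_transform_within[where d=1])
    fix y assume y: "y \<in> {a..b}"
    have "set_integrable lborel {a..y} J'"
      by (rule borel_integrable_atLeastAtMost')
         (use cont in \<open>auto intro: continuous_on_subset\<close>)
    from set_borel_integral_eq_integral(2)[OF this] J[of a y] y
    show "J a + integral {a..y} J' = J y" by simp
  qed (auto simp: a_def b_def)
  moreover have "at x within {a..b} = at x"
    by (rule at_within_interior) (auto simp: a_def b_def)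
  ultimately show ?thesis by simp
qed

lemma convolve_has_derivative:
  fixes p q q' :: "real \<Rightarrow> real"
  assumes "p \<in> borel_measurable borel" "q' \<in> borel_measurable borel"
    and "\<And>a x. a \<le> x \<Longrightarrow> q x - q a = (LINT s:{a..x}|lborel. q' s)"
    and "\<And>s. integrable lborel (\<lambda>y. q' (s - y) * p y)"
    and "\<And>s. (LINT y|lborel. \<bar>q' (s - y) * p y\<bar>) \<le> C"
    and "\<And>x. integrable lborel (\<lambda>y. q (x - y) * p y)"
    and "continuous_on UNIV (convolve q' p)"
  shows "(convolve q p has_real_derivative convolve q' p x) (at x)"
  by (rule integral_continuous_imp_derivative[OF convolve_increment(1)]) (use assms in auto)


section \<open>Smooth functions with Gaussian decay\<close>

text \<open>For \<open>r = 0\<close> only negative \<open>\<beta>\<close> occur: the condition is then a growth bound, satisfied by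
  polynomials. This makes functions of class \<open>r = 0\<close> multipliers of every class \<open>r\<close>.\<close>

definition gauss_bounded :: "real \<Rightarrow> (real \<Rightarrow> real) \<Rightarrow> bool" where
  "gauss_bounded r g \<longleftrightarrow> (\<forall>\<beta><r. \<exists>C. \<forall>x. \<bar>g x\<bar> \<le> C * exp (- (\<beta> * x\<^sup>2 / 2)))"

text \<open>The derivative is existentially quantified at each level, so that closure under sums,
  products and convolution only requires naming one derivative. The passage to iterates of
  \<open>deriv\<close> is left to \<open>C_gauss_higher_deriv\<close>.\<close>

primrec C_gauss :: "real \<Rightarrow> nat \<Rightarrow> (real \<Rightarrow> real) \<Rightarrow> bool" where
  "C_gauss r 0 g \<longleftrightarrow> continuous_on UNIV g \<and> gauss_bounded r g"
| "C_gauss r (Suc n) g \<longleftrightarrow> (continuous_on UNIV g \<and> gauss_bounded r g) \<and>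
     (\<exists>g'. (\<forall>x. (g has_real_derivative g' x) (at x)) \<and> C_gauss r n g')"

lemma C_gauss_imp: "C_gauss r n g \<Longrightarrow> continuous_on UNIV g \<and> gauss_bounded r g"
  by (cases n) auto

lemma C_gauss_SucD: "C_gauss r (Suc n) g \<Longrightarrow> C_gauss r n g"
proof (induction n arbitrary: g)
  case (Suc n)
  then obtain g' where "\<forall>x. (g has_real_derivative g' x) (at x)" "C_gauss r (Suc n) g'"
    and g: "continuous_on UNIV g \<and> gauss_bounded r g" by (subst (asm) C_gauss.simps) blast
  with Suc.IH[of g'] have "\<exists>g'. (\<forall>x. (g has_real_derivative g' x) (at x)) \<and> C_gauss r n g'"
    by blast
  with g show ?case by (subst C_gauss.simps) blast
qed simp

lemma gauss_bounded_add:
  assumes "gauss_bounded r f" "gauss_bounded r g"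
  shows "gauss_bounded r (\<lambda>x. f x + g x)"
  unfolding gauss_bounded_def
proof (intro allI impI)
  fix \<beta> assume "\<beta> < r"
  with assms obtain C D where
    C: "\<And>x. \<bar>f x\<bar> \<le> C * exp (- (\<beta> * x\<^sup>2 / 2))" and D: "\<And>x. \<bar>g x\<bar> \<le> D * exp (- (\<beta> * x\<^sup>2 / 2))"
    unfolding gauss_bounded_def by metis
  have "\<bar>f x + g x\<bar> \<le> (C + D) * exp (- (\<beta> * x\<^sup>2 / 2))" for x
    using C[of x] D[of x] unfolding distrib_right by linarith
  then show "\<exists>C. \<forall>x. \<bar>f x + g x\<bar> \<le> C * exp (- (\<beta> * x\<^sup>2 / 2))" by blast
qed

lemma gauss_bounded_mult:
  assumes "gauss_bounded 0 f" "gauss_bounded r g"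
  shows "gauss_bounded r (\<lambda>x. f x * g x)"
  unfolding gauss_bounded_def
proof (intro allI impI)
  fix \<beta> assume "\<beta> < r"
  \<comment> \<open>The rate is split as
    \<open>\<beta> = (\<beta> - r) / 2 + (\<beta> + r) / 2\<close>: the first summand is negative,
    hence available for class 0, and the second lies below \<open>r\<close>.\<close>
  then have "(\<beta> - r) / 2 < 0" "(\<beta> + r) / 2 < r" by auto
  with assms obtain C D where
    C: "\<And>x. \<bar>f x\<bar> \<le> C * exp (- ((\<beta> - r) / 2 * x\<^sup>2 / 2))"
    and D: "\<And>x. \<bar>g x\<bar> \<le> D * exp (- ((\<beta> + r) / 2 * x\<^sup>2 / 2))"
    unfolding gauss_bounded_def by metis
  have "\<bar>f x * g x\<bar> \<le> (C * D) * exp (- (\<beta> * x\<^sup>2 / 2))" for x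
  proof -
    have "\<bar>f x * g x\<bar> \<le> (C * exp (- ((\<beta> - r) / 2 * x\<^sup>2 / 2))) * (D * exp (- ((\<beta> + r) / 2 * x\<^sup>2 / 2)))"
      unfolding abs_mult using C[of x] D[of x] order_trans[OF abs_ge_zero C[of x]]
      by (intro mult_mono) auto
    also have "\<dots> = (C * D) * exp (- ((\<beta> - r) / 2 * x\<^sup>2 / 2) + - ((\<beta> + r) / 2 * x\<^sup>2 / 2))"
      unfolding exp_add by (simp only: mult_ac)
    also have "- ((\<beta> - r) / 2 * x\<^sup>2 / 2) + - ((\<beta> + r) / 2 * x\<^sup>2 / 2) = - (\<beta> * x\<^sup>2 / 2)"
      by (simp add: field_simps)
    finally show ?thesis .
  qed
  then show "\<exists>C. \<forall>x. \<bar>f x * g x\<bar> \<le> C * exp (- (\<beta> * x\<^sup>2 / 2))" by blast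
qed

lemma gauss_bounded_0_I:
  assumes "\<And>x. \<bar>f x\<bar> \<le> C * (1 + x\<^sup>2)"
  shows "gauss_bounded 0 f"
  unfolding gauss_bounded_def
proof (intro allI impI exI)
  fix \<beta> x :: real assume b: "\<beta> < 0"
  \<comment> \<open>With this choice \<open>exp (\<gamma> * x\<^sup>2)\<close> is exactly the growth
    allowed for \<open>\<beta>\<close>, and it dominates
    \<open>1 + \<gamma> * x\<^sup>2\<close>.\<close>
  define \<gamma> where "\<gamma> = - \<beta> / 2"
  have g: "\<gamma> > 0" using b by (simp add: \<gamma>_def)
  have "0 \<le> C * (1 + x\<^sup>2)" using order_trans[OF abs_ge_zero assms] .
  moreover have "0 < 1 + x\<^sup>2" by (simp add: add_pos_nonneg)
  ultimately have C: "0 \<le> C" by (simp add: zero_le_mult_iff)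
  have "1 + x\<^sup>2 \<le> (1 + 1 / \<gamma>) * (1 + \<gamma> * x\<^sup>2)"
    using g by (simp add: field_simps)
  also have "\<dots> \<le> (1 + 1 / \<gamma>) * exp (\<gamma> * x\<^sup>2)"
    using g exp_ge_add_one_self[of "\<gamma> * x\<^sup>2"] by (intro mult_left_mono) auto
  finally have "C * (1 + x\<^sup>2) \<le> C * ((1 + 1 / \<gamma>) * exp (\<gamma> * x\<^sup>2))"
    by (rule mult_left_mono[OF _ C])
  also have "\<dots> = (C * (1 + 1 / \<gamma>)) * exp (- (\<beta> * x\<^sup>2 / 2))"
    by (simp add: \<gamma>_def)
  finally show "\<bar>f x\<bar> \<le> (C * (1 + 1 / (- \<beta> / 2))) * exp (- (\<beta> * x\<^sup>2 / 2))"
    using assms[of x] by (simp add: \<gamma>_def)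
qed

section \<open>Closure properties of the regularity classes\<close>

lemma C_gauss_add:
  "C_gauss r n f \<Longrightarrow> C_gauss r n g \<Longrightarrow> C_gauss r n (\<lambda>x. f x + g x)"
proof (induction n arbitrary: f g)
  case 0 then show ?case by (auto intro: gauss_bounded_add continuous_intros)
next
  case (Suc n)
  from Suc.prems obtain f' g' where
    "\<And>x. (f has_real_derivative f' x) (at x)" "C_gauss r n f'"
    "\<And>x. (g has_real_derivative g' x) (at x)" "C_gauss r n g'" by auto
  then have "(\<forall>x. ((\<lambda>x. f x + g x) has_real_derivative (f' x + g' x)) (at x)) \<and>
      C_gauss r n (\<lambda>x. f' x + g' x)"
    using Suc.IH by (auto intro: derivative_intros)
  then show ?case
    using Suc.prems by (auto intro: gauss_bounded_add continuous_intros)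
qed

text \<open>In each term of the product rule one factor is undifferentiated;
  \<open>C_gauss_SucD\<close> lowers its level so that the induction hypothesis applies.\<close>

lemma C_gauss_mult:
  "C_gauss 0 n f \<Longrightarrow> C_gauss r n g \<Longrightarrow> C_gauss r n (\<lambda>x. f x * g x)"
proof (induction n arbitrary: f g)
  case 0 then show ?case by (auto intro: gauss_bounded_mult continuous_intros)
next
  case (Suc n)
  from Suc.prems obtain f' g' where
    d: "\<And>x. (f has_real_derivative f' x) (at x)" "C_gauss 0 n f'"
    "\<And>x. (g has_real_derivative g' x) (at x)" "C_gauss r n g'" by auto
  have "C_gauss r n (\<lambda>x. f' x * g x + f x * g' x)"
    using Suc.prems[THEN C_gauss_SucD] d by (intro C_gauss_add Suc.IH)
  moreover have "\<forall>x. ((\<lambda>x. f x * g x) has_real_derivative (f' x * g x + f x * g' x)) (at x)"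
    by (auto intro!: derivative_eq_intros d)
  ultimately show ?case
    using Suc.prems by (auto intro: gauss_bounded_mult continuous_intros)
qed

lemma C_gauss_const: "C_gauss 0 n (\<lambda>_. c)"
proof -
  have gb: "gauss_bounded 0 (\<lambda>_. c)" for c :: real
    by (rule gauss_bounded_0_I[of _ "\<bar>c\<bar>"]) (simp add: mult_le_cancel_left1 distrib_left)
  show ?thesis
  proof (induction n arbitrary: c)
    case (Suc n)
    from Suc[of 0] have "(\<forall>x. ((\<lambda>_. c) has_real_derivative (\<lambda>_. 0) x) (at x)) \<and> C_gauss 0 n (\<lambda>_. 0)"
      by simp
    then show ?case using gb[of c] unfolding C_gauss.simps by (auto intro!: exI[of _ "\<lambda>_. 0"])
  qed (use gb in auto)
qed

lemma C_gauss_ident: "C_gauss 0 n (\<lambda>x. x)"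
proof -
  have "\<bar>x\<bar> \<le> 1 * (1 + x\<^sup>2)" for x :: real
    using zero_le_power2[of "\<bar>x\<bar> - 1"] by (simp add: power2_eq_square algebra_simps) 
  then have gb: "gauss_bounded 0 (\<lambda>x. x)" by (rule gauss_bounded_0_I)
  show ?thesis
  proof (cases n)
    case (Suc m)
    have "(\<forall>x. ((\<lambda>x. x) has_real_derivative (\<lambda>_. 1) x) (at x)) \<and> C_gauss 0 m (\<lambda>_. 1)"
      using C_gauss_const by simp
    then show ?thesis using gb unfolding Suc C_gauss.simps by (auto intro!: exI[of _ "\<lambda>_. 1"])
  qed (use gb in auto)
qed

section \<open>Gaussian integrals and convolution with rapidly decaying functions\<close>

lemma integrable_gaussian:
  assumes "0 < a"
  shows "integrable lborel (\<lambda>x::real. exp (- (a * x\<^sup>2)))"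
    and "(LINT x|lborel. exp (- (a * x\<^sup>2))) = sqrt (pi / a)"
proof -
  \<comment> \<open>The standard deviation for which the normal density has exponent
    \<open>- (a * x\<^sup>2)\<close>.\<close>
  define s where "s = sqrt (1 / (2 * a))"
  have s: "s > 0" "s\<^sup>2 = 1 / (2 * a)" using assms by (auto simp: s_def)
  have eq: "normal_density 0 s x = 1 / sqrt (pi / a) * exp (- (a * x\<^sup>2))" for x
    using assms by (simp add: normal_density_def s)
  show "integrable lborel (\<lambda>x::real. exp (- (a * x\<^sup>2)))"
    using integrable_mult_right[of "sqrt (pi / a)", OF integrable_normal_moment[OF s(1), of 0 0]] assms
    unfolding eq by simp
  have "1 / sqrt (pi / a) * (LINT x|lborel. exp (- (a * x\<^sup>2))) = 1"
    using integral_normal_density[OF s(1), of 0] unfolding eq by (simp only: integral_mult_right_zero)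
  then have "(LINT x|lborel. exp (- (a * x\<^sup>2))) / sqrt (pi / a) = 1"
    by (simp only: times_divide_eq_left mult_1_left)
  then show "(LINT x|lborel. exp (- (a * x\<^sup>2))) = sqrt (pi / a)"
    by (rule divide_eq_1_iff[THEN iffD1, THEN conjunct2])
qed

lemma gauss_bounded_obtain:
  assumes "gauss_bounded r g" "0 < r"
  obtains \<beta> C where "0 < \<beta>" "0 \<le> C" "\<And>x. \<bar>g x\<bar> \<le> C * exp (- (\<beta> * x\<^sup>2 / 2))" "\<And>x. \<bar>g x\<bar> \<le> C"
proof -
  from assms obtain C where C: "\<And>x. \<bar>g x\<bar> \<le> C * exp (- (r / 2 * x\<^sup>2 / 2))"
    unfolding gauss_bounded_def by (metis field_sum_of_halves less_add_same_cancel1 half_gt_zero)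
  have C0: "0 \<le> C" using order_trans[OF abs_ge_zero C[of 0]] by simp
  have "\<bar>g x\<bar> \<le> C" for x
  proof -
    have "C * exp (- (r / 2 * x\<^sup>2 / 2)) \<le> C * 1" using C0 assms(2) by (intro mult_left_mono) auto
    with C[of x] show ?thesis by simp
  qed
  with C C0 assms(2) show ?thesis by (intro that[of "r/2" C]) auto
qed

lemma gauss_bounded_integrable:
  assumes "gauss_bounded r g" "0 < r" "continuous_on UNIV g"
  shows "integrable lborel g"
proof -
  obtain \<beta> C where b: "0 < \<beta>" "0 \<le> C" "\<And>x. \<bar>g x\<bar> \<le> C * exp (- (\<beta> * x\<^sup>2 / 2))"
    using gauss_bounded_obtain[OF assms(1,2)] by metis
  have I: "integrable lborel (\<lambda>x. C * exp (- (\<beta> * x\<^sup>2 / 2)))"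
    using integrable_gaussian(1)[of "\<beta>/2"] b(1) by (intro integrable_mult_right) simp
  show ?thesis
    using borel_measurable_continuous_onI[OF assms(3)] b order_trans[OF b(3) abs_ge_self]
    by (intro Bochner_Integration.integrable_bound[OF I]) auto
qed

text \<open>The shift is put on the continuous factor \<open>g\<close>, and dominated convergence
  needs one majorant for all shifts in a bounded range. The Gaussian tail of \<open>g\<close>
  supplies it at half the rate.\<close>

lemma convolve_continuous:
  assumes h: "L1_plus_Linf h k B" and g: "continuous_on UNIV g" "gauss_bounded r g" "0 < r"
  shows "continuous_on UNIV (convolve h g)"
proof -
  obtain \<beta> C where b: "0 < \<beta>" "0 \<le> C" "\<And>x. \<bar>g x\<bar> \<le> C * exp (- (\<beta> * x\<^sup>2 / 2))" "\<And>x. \<bar>g x\<bar> \<le> C"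
    using gauss_bounded_obtain[OF g(2,3)] by metis
  have [measurable]: "h \<in> borel_measurable borel" "g \<in> borel_measurable borel"
    and k: "integrable lborel k" "\<And>x. 0 \<le> k x" "0 \<le> B" "\<And>x. \<bar>h x\<bar> \<le> k x + B"
    using h g by (auto simp: L1_plus_Linf_def intro: borel_measurable_continuous_onI)
  have "isCont (convolve h g) x" for x
    unfolding continuous_at_sequentially
  proof (intro allI impI)
    fix X assume X: "X \<longlonglongrightarrow> x"
    obtain D where D: "\<And>n. \<bar>X n - x\<bar> \<le> D"
      using convergent_imp_Bseq[OF convergentI[OF tendsto_diff[OF X tendsto_const[of x]]]]
      by (auto simp: Bseq_def)
    \<comment> \<open>The first term pairs \<open>k\<close> with the sup bound of \<open>g\<close>,
      the second pairs \<open>B\<close> with its tail. The rate \<open>\<beta> / 4\<close> and the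
      factor \<open>exp (\<beta> * D\<^sup>2 / 2)\<close> come from
      \<open>(x - y)\<^sup>2 \<le> 2 * (X n - y)\<^sup>2 + 2 * D\<^sup>2\<close>.\<close>
    define w where "w y = C * k y + B * (C * exp (\<beta> * D\<^sup>2 / 2)) * exp (- (\<beta> / 4 * (x - y)\<^sup>2))" for y
    have "integrable lborel (\<lambda>y. exp (- (\<beta> / 4 * (x - y)\<^sup>2)))"
      using integrable_gaussian(1)[of "\<beta> / 4"] b(1)
      by (subst integrable_reflect_iff[of "\<lambda>y. exp (- (\<beta> / 4 * y\<^sup>2))"]) simp
    then have w: "integrable lborel w"
      unfolding w_def using k(1)
      by (intro Bochner_Integration.integrable_add integrable_mult_right)
    have bound: "\<bar>g (X n - y) * h y\<bar> \<le> w y" for n y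
    proof -
      have "(x - y)\<^sup>2 \<le> 2 * (X n - y)\<^sup>2 + 2 * (X n - x)\<^sup>2"
        using zero_le_power2[of "(X n - y) + (X n - x)"]
        by (simp add: power2_eq_square algebra_simps)
      also have "(X n - x)\<^sup>2 \<le> D\<^sup>2"
        using D[of n] abs_le_square_iff[of "X n - x" D] by fastforce
      finally have "\<beta> * (x - y)\<^sup>2 \<le> \<beta> * (2 * (X n - y)\<^sup>2 + 2 * D\<^sup>2)"
        using b(1) by (intro mult_left_mono) auto
      then have "- (\<beta> * (X n - y)\<^sup>2 / 2) \<le> \<beta> * D\<^sup>2 / 2 + - (\<beta> / 4 * (x - y)\<^sup>2)"
        by (simp add: algebra_simps)
      then have "C * exp (- (\<beta> * (X n - y)\<^sup>2 / 2)) \<le> C * exp (\<beta> * D\<^sup>2 / 2 + - (\<beta> / 4 * (x - y)\<^sup>2))"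
        using b(2) by (intro mult_left_mono) auto
      with b(3)[of "X n - y"] have g1: "\<bar>g (X n - y)\<bar> \<le> C * exp (\<beta> * D\<^sup>2 / 2) * exp (- (\<beta> / 4 * (x - y)\<^sup>2))"
        by (simp only: exp_add mult.assoc)
      have "\<bar>g (X n - y) * h y\<bar> \<le> \<bar>g (X n - y)\<bar> * (k y + B)"
        unfolding abs_mult using k(4)[of y] by (intro mult_left_mono) auto
      also have "\<dots> = \<bar>g (X n - y)\<bar> * k y + B * \<bar>g (X n - y)\<bar>" by (simp add: algebra_simps)
      also have "\<dots> \<le> C * k y + B * (C * exp (\<beta> * D\<^sup>2 / 2) * exp (- (\<beta> / 4 * (x - y)\<^sup>2)))"
        using b(4) k(2,3) g1 by (intro add_mono mult_right_mono mult_left_mono) auto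
      finally show ?thesis by (simp add: w_def mult.assoc)
    qed
    have "(\<lambda>n. LINT y|lborel. g (X n - y) * h y) \<longlonglongrightarrow> (LINT y|lborel. g (x - y) * h y)"
    proof (rule integral_dominated_convergence[OF _ _ w])
      show "AE y in lborel. (\<lambda>n. g (X n - y) * h y) \<longlonglongrightarrow> g (x - y) * h y"
      proof (intro AE_I2 tendsto_mult tendsto_const)
        fix y
        have "isCont g (x - y)" using g(1) by (simp add: continuous_on_eq_continuous_at)
        then show "(\<lambda>n. g (X n - y)) \<longlonglongrightarrow> g (x - y)"
          by (rule isCont_tendsto_compose) (intro tendsto_intros X)
      qed
    qed (use bound in auto)
    then show "(convolve h g \<circ> X) \<longlonglongrightarrow> convolve h g x"
      unfolding o_def convolve_commute[of h g] by (simp add: convolve_def)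
  qed
  then show ?thesis by (simp add: continuous_on_eq_continuous_at)
qed

lemma FTC_set_lebesgue:
  fixes g g' :: "real \<Rightarrow> real"
  assumes "\<And>x. (g has_real_derivative g' x) (at x)" "continuous_on UNIV g'" "a \<le> x"
  shows "g x - g a = (LINT s:{a..x}|lborel. g' s)"
proof -
  have "(\<integral>s. g' s * indicator {a..x} s \<partial>lborel) = g x - g a"
    using assms
    by (intro integral_FTC_Icc_real) (auto simp: continuous_on_eq_continuous_at intro: DERIV_subset)
  then show ?thesis by (simp add: set_lebesgue_integral_def mult.commute)
qed

lemma L1_plus_Linf_gauss_convolve:
  assumes h: "L1_plus_Linf h k B" and g: "continuous_on UNIV g" "gauss_bounded r g" "0 < r"
  shows "integrable lborel (\<lambda>y. h (x - y) * g y)"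
    and "\<exists>C. \<forall>x. (LINT y|lborel. \<bar>h (x - y) * g y\<bar>) \<le> C"
    and "\<exists>C. \<forall>x. \<bar>convolve h g x\<bar> \<le> C"
proof -
  obtain C where b: "\<And>x. \<bar>g x\<bar> \<le> C"
    using gauss_bounded_obtain[OF g(2,3)] by metis
  have "integrable lborel g" using gauss_bounded_integrable g by blast
  from L1_plus_Linf_convolve[OF h this b] show
    "integrable lborel (\<lambda>y. h (x - y) * g y)"
    "\<exists>C. \<forall>x. (LINT y|lborel. \<bar>h (x - y) * g y\<bar>) \<le> C"
    "\<exists>C. \<forall>x. \<bar>convolve h g x\<bar> \<le> C" by blast+
qed

text \<open>No regularity of \<open>h\<close> is available, so the derivative falls on
  \<open>g\<close>: after commuting the factors, \<open>g\<close> takes the place of the absolutely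
  continuous function in \<open>convolve_has_derivative\<close>.\<close>

lemma convolve_C_gauss_derivative:
  assumes h: "L1_plus_Linf h k B"
    and g: "\<And>x. (g has_real_derivative g' x) (at x)" "continuous_on UNIV g" "gauss_bounded r g"
      "continuous_on UNIV g'" "gauss_bounded r g'" and r: "0 < r"
  shows "(convolve h g has_real_derivative convolve h g' x) (at x)"
proof -
  have [measurable]: "h \<in> borel_measurable borel" using h by (simp add: L1_plus_Linf_def)
  obtain C where C: "\<And>x. (LINT y|lborel. \<bar>h (x - y) * g' y\<bar>) \<le> C"
    using L1_plus_Linf_gauss_convolve(2)[OF h g(4,5) r] by blast
  have swap: "convolve h f = convolve f h" for f by (rule ext) (rule convolve_commute)
  have refl: "integrable lborel (\<lambda>y. f (x - y) * h y) \<longleftrightarrow> integrable lborel (\<lambda>y. h (x - y) * f y)" for f x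
    using integrable_reflect_iff[of "\<lambda>y. h (x - y) * f y" x] by (simp add: mult.commute)
  show ?thesis unfolding swap
  proof (rule convolve_has_derivative)
    show "g' \<in> borel_measurable borel" using g(4) by (rule borel_measurable_continuous_onI)
    show "integrable lborel (\<lambda>y. g' (s - y) * h y)" for s
      unfolding refl by (rule L1_plus_Linf_gauss_convolve[OF h g(4,5) r])
    show "integrable lborel (\<lambda>y. g (s - y) * h y)" for s
      unfolding refl by (rule L1_plus_Linf_gauss_convolve[OF h g(2,3) r])
    show "(LINT y|lborel. \<bar>g' (s - y) * h y\<bar>) \<le> C" for s
      using C[of s] integral_reflect[of "\<lambda>y. \<bar>h (s - y) * g' y\<bar>" s] by (simp add: mult.commute)
    show "continuous_on UNIV (convolve g' h)"
      using convolve_continuous[OF h g(4,5) r] unfolding swap .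
  qed (use FTC_set_lebesgue[OF g(1,4)] in auto)
qed

text \<open>Convolution with the bounded part of \<open>h\<close> destroys decay, so only
  boundedness survives and the class drops from \<open>r\<close> to 0. Class 0 is what a multiplier
  needs, so multiplying by \<open>g\<close> returns to class \<open>r\<close>.\<close>

lemma convolve_C_gauss:
  assumes h: "L1_plus_Linf h k B" and r: "0 < r"
  shows "C_gauss r n g \<Longrightarrow> C_gauss 0 n (convolve h g)"
proof (induction n arbitrary: g)
  case 0
  then obtain C where "\<And>x. \<bar>convolve h g x\<bar> \<le> C"
    using L1_plus_Linf_gauss_convolve(3)[OF h _ _ r, of g] by auto
  then have "\<bar>convolve h g x\<bar> \<le> \<bar>C\<bar> * (1 + x\<^sup>2)" for x
    by (smt (verit) mult_left_le mult_le_cancel_left1 zero_le_power2)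
  then show ?case using 0 convolve_continuous[OF h _ _ r, of g] by (auto intro: gauss_bounded_0_I)
next
  case (Suc n)
  then obtain g' where d: "\<And>x. (g has_real_derivative g' x) (at x)" "C_gauss r n g'" by auto
  have "\<forall>x. (convolve h g has_real_derivative convolve h g' x) (at x)"
    using convolve_C_gauss_derivative[OF h d(1) _ _ _ _ r] C_gauss_imp[OF Suc.prems] C_gauss_imp[OF d(2)]
    by blast
  moreover have "C_gauss 0 n (convolve h g')" by (rule Suc.IH[OF d(2)])
  moreover have "C_gauss 0 n (convolve h g)" by (rule Suc.IH[OF C_gauss_SucD[OF Suc.prems]])
  ultimately show ?case unfolding C_gauss.simps using C_gauss_imp by blast
qed

text \<open>Each differentiation uses up one level, so the induction over \<open>n\<close> must keep
  the level \<open>m\<close> arbitrary.\<close>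

lemma C_gauss_higher_deriv:
  "(\<And>n. C_gauss r n g) \<Longrightarrow> C_gauss r m ((deriv ^^ n) g) \<and> (\<forall>x. (deriv ^^ n) g field_differentiable at x)"
proof (induction n arbitrary: m)
  case 0
  then show ?case using 0[of 1] by (auto simp: field_differentiable_def)
next
  case (Suc n)
  have *: "C_gauss r k (deriv ((deriv ^^ n) g))" for k
  proof -
    obtain g' where "\<And>x. ((deriv ^^ n) g has_real_derivative g' x) (at x)" "C_gauss r k g'"
      using Suc.IH[of "Suc k"] Suc.prems by auto
    moreover from this(1) have "deriv ((deriv ^^ n) g) = g'" by (auto intro: DERIV_imp_deriv)
    ultimately show ?thesis by simp
  qed
  from *[of 1] have "deriv ((deriv ^^ n) g) field_differentiable at x" for x
    by (auto simp: field_differentiable_def)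
  with * show ?case by simp
qed

lemma C_gauss_smooth: "(\<And>n. C_gauss r n g) \<Longrightarrow> smooth g"
  using C_gauss_higher_deriv unfolding smooth_def by blast


section \<open>Smooth bump functions\<close>

text \<open>Iterates of \<open>deriv\<close> never leave \<open>S\<close>, so smoothness needs no
  formula for the n-th derivative, only a family that is stable under differentiation.\<close>

lemma smooth_coinduct:
  assumes "g \<in> S"
    and "\<And>g. g \<in> S \<Longrightarrow> \<exists>g'. g' \<in> S \<and> (\<forall>x. (g has_real_derivative g' x) (at x))"
  shows "smooth g"
proof -
  have step: "(deriv ^^ n) g \<in> S" for n
  proof (induction n)
    case (Suc n)
    then obtain g' where g': "g' \<in> S" "\<And>x. ((deriv ^^ n) g has_real_derivative g' x) (at x)"
      using assms(2) by blast
    then have "deriv ((deriv ^^ n) g) = g'" by (auto intro: DERIV_imp_deriv)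
    with g' show ?case by simp
  qed (use assms in simp)
  then show ?thesis
    using assms(2) unfolding smooth_def field_differentiable_def by metis
qed

lemma smoothD:
  assumes "smooth g"
  shows "(g has_real_derivative deriv g x) (at x)" and "smooth (deriv g)"
proof -
  have "(deriv ^^ 0) g field_differentiable at x" using assms unfolding smooth_def by blast
  then show "(g has_real_derivative deriv g x) (at x)"
    by (simp add: DERIV_deriv_iff_field_differentiable)
  have "(deriv ^^ n) (deriv g) field_differentiable at x" for n x
  proof -
    have "(deriv ^^ n) (deriv g) = (deriv ^^ Suc n) g" by (simp only: funpow_Suc_right o_apply)
    then show ?thesis using assms unfolding smooth_def by metis
  qed
  then show "smooth (deriv g)" unfolding smooth_def by blast
qed

inductive_set sum_of_smooth_products :: "(real \<Rightarrow> real) set" where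
  prod: "smooth f \<Longrightarrow> smooth g \<Longrightarrow> (\<lambda>x. f x * g x) \<in> sum_of_smooth_products"
| sum: "f \<in> sum_of_smooth_products \<Longrightarrow> g \<in> sum_of_smooth_products
    \<Longrightarrow> (\<lambda>x. f x + g x) \<in> sum_of_smooth_products"

lemma smooth_mult:
  assumes "smooth f" "smooth g"
  shows "smooth (\<lambda>x. f x * g x)"
proof (rule smooth_coinduct)
  show "(\<lambda>x. f x * g x) \<in> sum_of_smooth_products" using assms by (rule prod)
  fix h assume "h \<in> sum_of_smooth_products"
  then show "\<exists>h'. h' \<in> sum_of_smooth_products \<and> (\<forall>x. (h has_real_derivative h' x) (at x))"
  proof induction
    case (prod f g)
    have "(\<lambda>x. deriv f x * g x + f x * deriv g x) \<in> sum_of_smooth_products"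
      using prod smoothD(2) by (intro sum_of_smooth_products.intros) auto
    moreover have "\<forall>x. ((\<lambda>x. f x * g x) has_real_derivative deriv f x * g x + f x * deriv g x) (at x)"
      using smoothD(1)[OF prod(1)] smoothD(1)[OF prod(2)] by (auto intro!: derivative_eq_intros)
    ultimately show ?case by (intro exI[of _ "\<lambda>x. deriv f x * g x + f x * deriv g x"]) auto
  next
    case (sum f g)
    then obtain f' g' where "f' \<in> sum_of_smooth_products" "\<forall>x. (f has_real_derivative f' x) (at x)"
      "g' \<in> sum_of_smooth_products" "\<forall>x. (g has_real_derivative g' x) (at x)" by blast
    then show ?case
      by (intro exI[of _ "\<lambda>x. f' x + g' x"] conjI sum_of_smooth_products.sum)
         (auto intro: derivative_intros)
  qed
qed

text \<open>Each differentiation produces a factor \<open>m\<close>; the stable family therefore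
  carries a free scalar \<open>k\<close>.\<close>

lemma smooth_affine:
  assumes "smooth f"
  shows "smooth (\<lambda>x. f (m * x + q))"
proof (rule smooth_coinduct)
  show "(\<lambda>x. f (m * x + q)) \<in> {\<lambda>x. k * f (m * x + q) | k f. smooth f}"
    using assms by (auto intro!: exI[of _ "1::real"] exI[of _ f])
  fix g assume "g \<in> {\<lambda>x. k * f (m * x + q) | k f. smooth f}"
  then obtain k f where g: "g = (\<lambda>x. k * f (m * x + q))" and f: "smooth f" by blast
  have "((\<lambda>x. f (m * x + q)) has_real_derivative deriv f (m * x + q) * m) (at x)" for x
    by (rule DERIV_chain2[OF smoothD(1)[OF f]]) (auto intro!: derivative_eq_intros)
  then have "(g has_real_derivative (k * m) * deriv f (m * x + q)) (at x)" for x
    unfolding g by (rule DERIV_cong[OF DERIV_cmult]) simp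
  then show "\<exists>g'. g' \<in> {\<lambda>x. k * f (m * x + q) | k f. smooth f} \<and> (\<forall>x. (g has_real_derivative g' x) (at x))"
    using smoothD(2)[OF f] by (intro exI[of _ "\<lambda>x. (k * m) * deriv f (m * x + q)"]) auto
qed

text \<open>For \<open>P = 1\<close> this is the classical function \<open>exp (- 1 / t)\<close>
  that is flat at 0. The polynomial in \<open>1 / t\<close> makes the family stable under
  differentiation.\<close>

definition flat :: "real poly \<Rightarrow> real \<Rightarrow> real" where
  "flat P t = (if t > 0 then poly P (1 / t) * exp (- (1 / t)) else 0)"

lemma poly_exp_tendsto_0: "((\<lambda>s. poly P s * exp (- s)) \<longlongrightarrow> (0::real)) at_top"
proof -
  have "((\<lambda>s. \<Sum>i\<le>degree P. coeff P i * (s ^ i / exp s)) \<longlongrightarrow> (\<Sum>i\<le>degree P. coeff P i * 0)) at_top"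
    by (intro tendsto_sum tendsto_mult tendsto_const tendsto_power_div_exp_0)
  then show ?thesis
    by (simp add: poly_altdef sum_distrib_right exp_minus divide_inverse mult.assoc)
qed

lemma flat_tendsto_0: "(flat P \<longlongrightarrow> 0) (at 0)"
proof (rule filterlim_split_at)
  show "(flat P \<longlongrightarrow> 0) (at_left 0)"
    by (rule tendsto_eventually) (auto simp: flat_def eventually_at_filter)
  have "((\<lambda>t. poly P (inverse t) * exp (- inverse t)) \<longlongrightarrow> 0) (at_right 0)"
    by (rule filterlim_compose[OF poly_exp_tendsto_0 filterlim_inverse_at_top_right])
  then show "(flat P \<longlongrightarrow> 0) (at_right 0)"
    by (rule Lim_transform_eventually)
       (auto simp: flat_def eventually_at_filter inverse_eq_divide)
qed

text \<open>With \<open>s = 1 / t\<close> one has \<open>ds/dt = - s^2\<close>, so differentiating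
  \<open>P(s) exp(-s)\<close> gives \<open>s^2 (P - P')(s) exp(-s)\<close>; the factor
  \<open>[:0,0,1:]\<close> is \<open>s^2\<close>.\<close>

lemma flat_has_derivative:
  "(flat P has_real_derivative flat ([:0,0,1:] * (P - pderiv P)) x) (at x)"
proof -
  consider "x > 0" | "x < 0" | "x = 0" by linarith
  then show ?thesis
  proof cases
    case 1
    have "((\<lambda>t. poly P (1 / t) * exp (- (1 / t))) has_real_derivative
        flat ([:0,0,1:] * (P - pderiv P)) x) (at x)"
      using 1 by (auto intro!: derivative_eq_intros DERIV_chain2[OF poly_DERIV]
        simp: flat_def field_simps power2_eq_square)
    then show ?thesis
      by (rule has_field_derivative_transform_within_open[of _ _ _ "{0<..}"])
         (use 1 in \<open>auto simp: flat_def\<close>)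
  next
    case 2
    have "((\<lambda>t. 0) has_real_derivative flat ([:0,0,1:] * (P - pderiv P)) x) (at x)"
      using 2 by (simp add: flat_def)
    then show ?thesis
      by (rule has_field_derivative_transform_within_open[of _ _ _ "{..<0}"])
         (use 2 in \<open>auto simp: flat_def\<close>)
  next
    case 3
    \<comment> \<open>Division by \<open>t\<close> multiplies the polynomial by
      \<open>s = 1 / t\<close>, so the difference quotient at 0 is again a flat function and tends
      to 0.\<close>
    have "((\<lambda>t. (flat P t - flat P 0) / (t - 0)) \<longlongrightarrow> 0) (at 0)"
      by (rule Lim_transform_eventually[OF flat_tendsto_0[of "[:0,1:] * P"]])
         (auto simp: flat_def eventually_at_filter)
    then show ?thesis
      using 3 by (simp add: has_field_derivative_iff flat_def)
  qed
qed

lemma smooth_flat: "smooth (flat P)"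
proof (rule smooth_coinduct)
  fix g assume "g \<in> range flat"
  then show "\<exists>g'. g' \<in> range flat \<and> (\<forall>x. (g has_real_derivative g' x) (at x))"
    using flat_has_derivative by blast
qed simp

text \<open>A smooth approximation of the indicator of the open interval from \<open>a\<close> to
  \<open>b\<close>: as \<open>n\<close> grows both flat factors tend to 1 inside, while the function
  always vanishes outside. The form is invariant under reflection and translation up to a change of
  \<open>a\<close> and \<open>b\<close>.\<close>

definition bump :: "nat \<Rightarrow> real \<Rightarrow> real \<Rightarrow> real \<Rightarrow> real" where
  "bump n a b x = flat 1 (real (Suc n) * (x - a)) * flat 1 (real (Suc n) * (b - x))"

lemma smooth_bump: "smooth (bump n a b)"
proof -
  have "bump n a b = (\<lambda>x. flat 1 (real (Suc n) * x + (- real (Suc n) * a))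
      * flat 1 (- real (Suc n) * x + real (Suc n) * b))"
    by (rule ext) (simp add: bump_def algebra_simps)
  then show ?thesis by (simp only: smooth_mult smooth_affine smooth_flat)
qed

lemma bump_eq_0:
  assumes "x \<notin> {a<..<b}" shows "bump n a b x = 0"
proof -
  have "x - a \<le> 0 \<or> b - x \<le> 0" using assms by auto
  then have "real (Suc n) * (x - a) \<le> 0 \<or> real (Suc n) * (b - x) \<le> 0"
    by (auto simp del: of_nat_Suc intro: mult_nonneg_nonpos)
  then show ?thesis
    unfolding bump_def flat_def by (auto simp del: of_nat_Suc simp: not_less[symmetric])
qed

lemma bump_bounds: "0 \<le> bump n a b x" "bump n a b x \<le> indicator {a..b} x"
proof -
  have fl: "0 \<le> flat 1 t \<and> flat 1 t \<le> 1" for t by (simp add: flat_def)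
  show "0 \<le> bump n a b x" unfolding bump_def using fl by simp
  show "bump n a b x \<le> indicator {a..b} x"
  proof (cases "x \<in> {a..b}")
    case True
    have "bump n a b x \<le> 1 * 1" unfolding bump_def using fl by (intro mult_mono) auto
    with True show ?thesis by simp
  next
    case False
    then have "bump n a b x = 0" by (intro bump_eq_0) auto
    with False show ?thesis by simp
  qed
qed

lemma test_function_bump: "test_function (bump n a b)"
proof -
  have "{x. bump n a b x \<noteq> 0} \<subseteq> {a..b}"
  proof
    fix x assume "x \<in> {x. bump n a b x \<noteq> 0}"
    then show "x \<in> {a..b}" using bump_bounds[of n a b x] by (cases "x \<in> {a..b}") auto
  qed
  then have "bounded {x. bump n a b x \<noteq> 0}"
    using bounded_closed_interval bounded_subset by blast
  then have "compact (closure {x. bump n a b x \<noteq> 0})" by simp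
  then show ?thesis by (simp add: test_function_def smooth_bump)
qed

lemma bump_tendsto: "(\<lambda>n. bump n a b x) \<longlonglongrightarrow> indicator {a<..<b} x"
proof (cases "x \<in> {a<..<b}")
  case True
  have lim: "(\<lambda>n. flat 1 (real (Suc n) * t)) \<longlonglongrightarrow> 1" if "t > 0" for t
  proof -
    have "(\<lambda>n. exp (- (1 / real (Suc n) * (1 / t)))) \<longlonglongrightarrow> exp (- (0 * (1 / t)))"
      using LIMSEQ_inverse_real_of_nat
      by (intro tendsto_intros) (simp add: inverse_eq_divide)
    then show ?thesis using that by (simp add: flat_def zero_less_mult_iff)
  qed
  have "(\<lambda>n. flat 1 (real (Suc n) * (x - a)) * flat 1 (real (Suc n) * (b - x))) \<longlonglongrightarrow> 1 * 1"
    using True by (intro tendsto_mult lim) auto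
  then show ?thesis using True unfolding bump_def by simp
next
  case False
  then show ?thesis by (simp add: bump_eq_0)
qed


section \<open>Absolutely continuous representatives of Sobolev functions\<close>

text \<open>The product with \<open>exp (\<beta> * x\<^sup>2 / 2)\<close> is continuous on a compact
  interval, hence bounded, for every \<open>\<beta>\<close>. This makes bumps admissible in the
  convolution lemmas for decaying functions.\<close>

lemma gauss_bounded_compact_support:
  assumes g: "continuous_on UNIV g" and supp: "\<And>x. x \<notin> {a..b} \<Longrightarrow> g x = 0"
  shows "gauss_bounded r g"
  unfolding gauss_bounded_def
proof (intro allI impI)
  fix \<beta> :: real
  have "continuous_on {a..b} (\<lambda>x. g x * exp (\<beta> * x\<^sup>2 / 2))"
    by (intro continuous_intros continuous_on_subset[OF g]) auto
  then have "bounded ((\<lambda>x. g x * exp (\<beta> * x\<^sup>2 / 2)) ` {a..b})"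
    by (intro compact_imp_bounded compact_continuous_image) auto
  then obtain C where C: "\<And>x. x \<in> {a..b} \<Longrightarrow> \<bar>g x * exp (\<beta> * x\<^sup>2 / 2)\<bar> \<le> C"
    unfolding bounded_iff by fastforce
  have "\<bar>g x\<bar> \<le> \<bar>C\<bar> * exp (- (\<beta> * x\<^sup>2 / 2))" for x
  proof (cases "x \<in> {a..b}")
    case True
    have "\<bar>g x\<bar> = \<bar>g x * exp (\<beta> * x\<^sup>2 / 2)\<bar> * exp (- (\<beta> * x\<^sup>2 / 2))"
      by (simp add: abs_mult exp_minus)
    also have "\<dots> \<le> \<bar>C\<bar> * exp (- (\<beta> * x\<^sup>2 / 2))"
      using C[OF True] by (intro mult_right_mono) auto
    finally show ?thesis .
  qed (simp add: supp)
  then show "\<exists>C. \<forall>x. \<bar>g x\<bar> \<le> C * exp (- (\<beta> * x\<^sup>2 / 2))" by blast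
qed

lemma bump_regular:
  shows "(bump n a b has_real_derivative deriv (bump n a b) x) (at x)"
    and "continuous_on UNIV (bump n a b)" "gauss_bounded r (bump n a b)"
    and "continuous_on UNIV (deriv (bump n a b))" "gauss_bounded r (deriv (bump n a b))"
proof -
  have cont: "continuous_on UNIV f" if "smooth f" for f
    using smoothD(1)[OF that] by (auto intro: DERIV_isCont simp: continuous_on_eq_continuous_at)
  note s = smooth_bump[of n a b]
  show "(bump n a b has_real_derivative deriv (bump n a b) x) (at x)" by (rule smoothD(1)[OF s])
  show c: "continuous_on UNIV (bump n a b)" by (rule cont[OF s])
  show c': "continuous_on UNIV (deriv (bump n a b))" by (rule cont[OF smoothD(2)[OF s]])
  show "gauss_bounded r (bump n a b)"
    by (rule gauss_bounded_compact_support[OF c, of a b]) (auto simp: bump_eq_0)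
  show "gauss_bounded r (deriv (bump n a b))"
  proof (rule gauss_bounded_compact_support[OF c', of a b])
    fix x assume x: "x \<notin> {a..b}"
    have "((\<lambda>_. 0) has_real_derivative 0) (at x)" by simp
    then have "(bump n a b has_real_derivative 0) (at x)"
      by (rule has_field_derivative_transform_within_open[of _ _ _ "- {a..b}"])
         (use x in \<open>auto simp: bump_eq_0\<close>)
    then show "deriv (bump n a b) x = 0" by (rule DERIV_imp_deriv)
  qed
qed

text \<open>The weak identity is tested against \<open>y \<mapsto> bump n a b (x - y)\<close>, which
  is again a bump, with endpoints \<open>x - b\<close> and \<open>x - a\<close>. Its reflected
  derivative contributes a sign that cancels the one in the definition of the weak
  derivative.\<close>

lemma convolve_bump_weak_derivative:
  assumes wd: "has_weak_derivative K K'" and K: "L1_plus_Linf K k B"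
  shows "(convolve K (bump n a b) has_real_derivative convolve K' (bump n a b) x) (at x)"
proof -
  have refl: "bump n (x - b) (x - a) = (\<lambda>y. bump n a b (x - y))"
    by (rule ext) (simp add: bump_def algebra_simps)
  have der: "deriv (bump n (x - b) (x - a)) y = - deriv (bump n a b) (x - y)" for y
  proof -
    have "((\<lambda>y. bump n a b (x - y)) has_real_derivative deriv (bump n a b) (x - y) * - 1) (at y)"
      by (rule DERIV_chain2[OF bump_regular(1)]) (auto intro!: derivative_eq_intros)
    then show ?thesis unfolding refl by (simp add: DERIV_imp_deriv)
  qed
  have "(LINT y|lborel. K y * deriv (bump n (x - b) (x - a)) y)
      = - (LINT y|lborel. K' y * bump n (x - b) (x - a) y)"
    using wd test_function_bump unfolding has_weak_derivative_def by blast
  then have "(LINT y|lborel. deriv (bump n a b) (x - y) * K y) = (LINT y|lborel. bump n a b (x - y) * K' y)"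
    unfolding der unfolding refl by (simp add: mult.commute)
  then have "convolve K (deriv (bump n a b)) x = convolve K' (bump n a b) x"
    unfolding convolve_commute[of K] convolve_commute[of K'] by (simp add: convolve_def)
  moreover have "(convolve K (bump n a b) has_real_derivative convolve K (deriv (bump n a b)) x) (at x)"
    by (rule convolve_C_gauss_derivative[OF K bump_regular, of 1]) simp
  ultimately show ?thesis by simp
qed

text \<open>The positive and negative parts are densities of two measures that are finite and equal
  on right half-lines. Such half-lines determine the measure, and the measure determines its density
  almost everywhere.\<close>

lemma halfline_integrals_zero_imp_AE_zero:
  fixes f :: "real \<Rightarrow> real"
  assumes f: "integrable lborel f" and 0: "\<And>x. (LINT y:{x<..}|lborel. f y) = 0"
  shows "AE x in lborel. f x = 0"
proof -
  have [measurable]: "f \<in> borel_measurable borel" using f by simp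
  define p where "p x = max 0 (f x)" for x
  define m where "m x = max 0 (- f x)" for x
  have ip: "integrable lborel p" and im: "integrable lborel m"
    unfolding p_def m_def using f by (auto intro!: Bochner_Integration.integrable_max)
  have [measurable]: "p \<in> borel_measurable borel" "m \<in> borel_measurable borel"
    using ip im by simp_all
  have em: "emeasure (density lborel (\<lambda>x. ennreal (q x))) A = ennreal (LINT y:A|lborel. q y)"
    if q: "integrable lborel q" "\<And>x. 0 \<le> q x" and A: "A \<in> sets borel" for q A
  proof -
    have "emeasure (density lborel (\<lambda>x. ennreal (q x))) A = (\<integral>\<^sup>+ x. ennreal (q x) * indicator A x \<partial>lborel)"
      using q(1) A by (subst emeasure_density) auto
    also have "\<dots> = (\<integral>\<^sup>+ x. ennreal (indicator A x * q x) \<partial>lborel)"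
      by (intro nn_integral_cong) (auto simp: indicator_def)
    also have "\<dots> = ennreal (LINT y:A|lborel. q y)"
      unfolding set_lebesgue_integral_def
      using q A integrable_mult_indicator[OF _ q(1), of A]
      by (subst nn_integral_eq_integral) auto
    finally show ?thesis .
  qed
  have "density lborel (\<lambda>x. ennreal (p x)) = density lborel (\<lambda>x. ennreal (m x))"
  proof (rule measure_eqI_lessThan)
    fix x
    have "set_integrable lborel {x<..} p" "set_integrable lborel {x<..} m"
      unfolding set_integrable_def
      by (rule integrable_mult_indicator; use ip im in simp)+
    then have "(LINT y:{x<..}|lborel. p y) - (LINT y:{x<..}|lborel. m y) = (LINT y:{x<..}|lborel. p y - m y)"
      by (rule set_integral_diff(2)[symmetric])
    also have "(\<lambda>y. p y - m y) = f" by (auto simp: p_def m_def)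
    finally have "(LINT y:{x<..}|lborel. p y) = (LINT y:{x<..}|lborel. m y)" using 0[of x] by simp
    then show "emeasure (density lborel (\<lambda>x. ennreal (p x))) {x<..}
        = emeasure (density lborel (\<lambda>x. ennreal (m x))) {x<..}"
      using em[OF ip] em[OF im] by (simp add: p_def m_def)
    show "emeasure (density lborel (\<lambda>x. ennreal (p x))) {x<..} < \<infinity>"
      using em[OF ip] by (simp add: p_def)
  qed simp_all
  then have "AE x in lborel. ennreal (p x) = ennreal (m x)"
    by (intro sigma_finite_measure.density_unique[OF sigma_finite_lborel]) auto
  then show ?thesis by eventually_elim (auto simp: p_def m_def max_def split: if_splits)
qed

text \<open>The fundamental lemma of the calculus of variations, with bumps as the only test
  functions: in the limit they give zero integral over every bounded open interval.\<close>

lemma bump_orthogonal_imp_AE_zero: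
  fixes D :: "real \<Rightarrow> real"
  assumes D: "locally_integrable D" and 0: "\<And>n a b. (LINT y|lborel. D y * bump n a b y) = 0"
  shows "AE x in lborel. D x = 0"
proof -
  have ind: "(LINT y|lborel. D y * indicator {a<..<b} y) = 0" for a b
  proof (rule LIMSEQ_unique)
    have int: "integrable lborel (\<lambda>y. indicator {a..b} y * D y)"
      using D unfolding locally_integrable_def set_integrable_def by auto
    \<comment> \<open>Local integrability gives measurability of truncations only; \<open>D\<close>
      is their pointwise limit.\<close>
    have m: "D \<in> borel_measurable lborel"
    proof (rule borel_measurable_LIMSEQ_real)
      show "(\<lambda>y. indicator {- real N..real N} y * D y) \<in> borel_measurable lborel" for N
        by (rule borel_measurable_integrable)
           (use D in \<open>simp add: locally_integrable_def set_integrable_def\<close>)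
      fix y
      have "\<forall>\<^sub>F N in sequentially. \<bar>y\<bar> \<le> real N"
        by (rule eventually_sequentiallyI[of "nat \<lceil>\<bar>y\<bar>\<rceil>"]) linarith
      then show "(\<lambda>N. indicator {- real N..real N} y * D y) \<longlonglongrightarrow> D y"
      proof (intro tendsto_eventually, eventually_elim)
        case (elim N)
        then have "y \<in> {- real N..real N}" by (simp add: abs_le_iff minus_le_iff)
        then show ?case by simp
      qed
    qed
    have [measurable]: "bump n a b \<in> borel_measurable borel" for n
      by (rule borel_measurable_continuous_onI[OF bump_regular(2)])
    show "(\<lambda>n. LINT y|lborel. D y * bump n a b y) \<longlonglongrightarrow> (LINT y|lborel. D y * indicator {a<..<b} y)"
    proof (rule integral_dominated_convergence[where w = "\<lambda>y. \<bar>indicator {a..b} y * D y\<bar>"])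
      show "AE y in lborel. (\<lambda>n. D y * bump n a b y) \<longlonglongrightarrow> D y * indicator {a<..<b} y"
        by (intro AE_I2 tendsto_mult tendsto_const bump_tendsto)
      fix n
      show "AE y in lborel. norm (D y * bump n a b y) \<le> \<bar>indicator {a..b} y * D y\<bar>"
      proof (intro AE_I2)
        fix y
        have "\<bar>D y\<bar> * bump n a b y \<le> \<bar>D y\<bar> * indicator {a..b} y"
          by (intro mult_left_mono bump_bounds) auto
        then show "norm (D y * bump n a b y) \<le> \<bar>indicator {a..b} y * D y\<bar>"
          using bump_bounds(1)[of n a b y] by (simp add: abs_mult mult.commute)
      qed
      show "integrable lborel (\<lambda>y. \<bar>indicator {a..b} y * D y\<bar>)"
        using int by (rule integrable_abs)
      show "(\<lambda>y. D y * bump n a b y) \<in> borel_measurable lborel"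
        using m by measurable
      show "(\<lambda>y. D y * indicator {a<..<b} y) \<in> borel_measurable lborel"
        using m by measurable
    qed
    show "(\<lambda>n. LINT y|lborel. D y * bump n a b y) \<longlonglongrightarrow> 0" using 0 by simp
  qed
  \<comment> \<open>Truncation makes \<open>D\<close> integrable, and a half-line cut with the
    window is again a bounded open interval. The countably many exceptional null sets are then
    united.\<close>
  have "AE x in lborel. indicator {- real N<..<real N} x * D x = 0" for N
  proof (rule halfline_integrals_zero_imp_AE_zero)
    have "set_integrable lborel {- real N<..<real N} D"
      using D unfolding locally_integrable_def
      by (rule_tac set_integrable_subset[of _ "{- real N..real N}"]) auto
    then show "integrable lborel (\<lambda>x. indicator {- real N<..<real N} x * D x)"
      by (simp add: set_integrable_def)
    fix x
    have "(LINT y:{x<..}|lborel. indicator {- real N<..<real N} y * D y)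
        = (LINT y|lborel. D y * indicator {max x (- real N)<..<real N} y)"
      unfolding set_lebesgue_integral_def
      by (intro Bochner_Integration.integral_cong) (auto simp: indicator_def)
    then show "(LINT y:{x<..}|lborel. indicator {- real N<..<real N} y * D y) = 0" using ind by simp
  qed
  then have "AE x in lborel. \<forall>N. indicator {- real N<..<real N} x * D x = 0"
    by (intro AE_all_countable[THEN iffD2] allI)
  then show ?thesis
  proof eventually_elim
    case (elim x)
    obtain N where "\<bar>x\<bar> < real N" using reals_Archimedean2 by blast
    then have "x \<in> {- real N<..<real N}" by auto
    with elim show ?case by (auto dest: spec[of _ N])
  qed
qed

section \<open>Primitives and their identification with the kernel\<close>

lemma indefinite_integral:
  fixes h :: "real \<Rightarrow> real"
  assumes "locally_integrable h"
  obtains G where "continuous_on UNIV G" "\<And>a x. a \<le> x \<Longrightarrow> G x - G a = (LINT s:{a..x}|lborel. h s)"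
proof -
  have si: "set_integrable lborel {a..b} h" for a b
    using assms by (simp add: locally_integrable_def)
  have HK: "h integrable_on {a..b}" "(LINT s:{a..b}|lborel. h s) = integral {a..b} h" for a b
    by (rule set_borel_integral_eq_integral[OF si])+
  define G where "G x = (if 0 \<le> x then integral {0..x} h else - integral {x..0} h)" for x
  have inc: "G x - G a = integral {a..x} h" if "a \<le> x" for a x
  proof -
    note comb = Henstock_Kurzweil_Integration.integral_combine[OF _ _ HK(1)]
    consider "0 \<le> a" | "x < 0" | "a < 0" "0 \<le> x" by linarith
    then show ?thesis
    proof cases
      case 1 then show ?thesis using that comb[of 0 a x] by (simp add: G_def)
    next
      case 2 then show ?thesis using that comb[of a x 0] by (simp add: G_def)
    next
      case 3 then show ?thesis using comb[of a 0 x] by (simp add: G_def)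
    qed
  qed
  have "isCont G x" for x
  proof -
    have "continuous_on {x-1..x+1} (\<lambda>u. G (x-1) + integral {x-1..u} h)"
      by (intro continuous_intros indefinite_integral_continuous_1 HK)
    then have "continuous_on {x-1..x+1} G"
    proof (rule continuous_on_eq)
      fix u assume "u \<in> {x-1..x+1}"
      then show "G (x-1) + integral {x-1..u} h = G u" using inc[of "x-1" u] by simp
    qed
    then show "isCont G x" by (rule continuous_on_interior) auto
  qed
  then show ?thesis
  proof (intro that[of G])
    show "continuous_on UNIV G" using \<open>\<And>x. isCont G x\<close> by (simp add: continuous_on_eq_continuous_at)
  qed (simp add: inc HK(2))
qed

lemma L1_plus_Linf_set_integral:
  assumes "L1_plus_Linf h k B" "locally_integrable h" "a \<le> x"
  shows "\<bar>LINT s:{a..x}|lborel. h s\<bar> \<le> (LINT y|lborel. k y) + B * (x - a)"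
proof -
  have k: "integrable lborel k" "\<And>x. 0 \<le> k x" "0 \<le> B" "\<And>x. \<bar>h x\<bar> \<le> k x + B"
    using assms by (auto simp: L1_plus_Linf_def)
  have I: "integrable lborel (\<lambda>s. k s + B * indicator {a..x} s)"
    using k(1) assms(3) by (intro Bochner_Integration.integrable_add integrable_mult_right) auto
  have h: "integrable lborel (\<lambda>s. indicator {a..x} s * h s)"
    using assms(2) by (simp add: locally_integrable_def set_integrable_def)
  have "\<bar>LINT s:{a..x}|lborel. h s\<bar> \<le> (LINT s|lborel. \<bar>indicator {a..x} s * h s\<bar>)"
    unfolding set_lebesgue_integral_def by (simp add: integral_abs_bound)
  also have "\<dots> \<le> (LINT s|lborel. k s + B * indicator {a..x} s)"
    using h I k by (intro integral_mono) (auto simp: indicator_def)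
  also have "\<dots> = (LINT y|lborel. k y) + B * (x - a)"
    using k(1) assms(3) by (subst Bochner_Integration.integral_add) auto
  finally show ?thesis .
qed

text \<open>A du Bois-Reymond argument by mollification. The difference \<open>w\<close> of the
  kernel and a primitive of \<open>K'\<close> has constant convolution with every bump, so each
  difference of translates \<open>w (x - y) - w (- y)\<close> is orthogonal to all bumps and
  vanishes for almost every \<open>y\<close>.\<close>

lemma weak_derivative_representation:
  assumes wd: "has_weak_derivative K K'"
    and K: "L1_plus_Linf K k B" and K': "L1_plus_Linf K' k' B'"
  obtains G where "continuous_on UNIV G"
    "\<And>a x. a \<le> x \<Longrightarrow> G x - G a = (LINT s:{a..x}|lborel. K' s)"
    "AE x in lborel. K x = G x"
proof -
  have loc: "locally_integrable K" "locally_integrable K'"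
    using wd by (auto simp: has_weak_derivative_def)
  obtain G where G: "continuous_on UNIV G" "\<And>a x. a \<le> x \<Longrightarrow> G x - G a = (LINT s:{a..x}|lborel. K' s)"
    using indefinite_integral[OF loc(2)] by blast
  have [measurable]: "K \<in> borel_measurable borel" "K' \<in> borel_measurable borel" "G \<in> borel_measurable borel"
    using K K' borel_measurable_continuous_onI[OF G(1)] by (simp_all add: L1_plus_Linf_def)
  define w where "w x = K x - G x" for x
  have [measurable]: "w \<in> borel_measurable borel" unfolding w_def by measurable
  have loc_refl: "locally_integrable (\<lambda>y. f (x - y))" if "locally_integrable f" for f and x :: real
    unfolding locally_integrable_def set_integrable_def
  proof (intro allI)
    fix a b
    have "integrable lborel (\<lambda>y. indicator {x-b..x-a} y *\<^sub>R f y)"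
      using that by (simp add: locally_integrable_def set_integrable_def)
    then have "integrable lborel (\<lambda>y. indicator {x-b..x-a} (x - y) *\<^sub>R f (x - y))"
      by (rule integrable_reflect_iff[THEN iffD2])
    moreover have "indicator {x-b..x-a} (x - y) = (indicator {a..b} y :: real)" for y
      by (auto simp: indicator_def)
    ultimately show "integrable lborel (\<lambda>y. indicator {a..b} y *\<^sub>R f (x - y))" by simp
  qed
  have locw: "locally_integrable w"
    unfolding locally_integrable_def w_def
  proof (intro allI set_integral_diff(1))
    show "set_integrable lborel {a..b} K" for a b using loc by (simp add: locally_integrable_def)
    show "set_integrable lborel {a..b} G" for a b
      by (rule borel_integrable_atLeastAtMost') (rule continuous_on_subset[OF G(1)], simp)
  qed
  have w_bump: "integrable lborel (\<lambda>y. f (x - y) * bump n a b y)" if "locally_integrable f" for f x n a b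
  proof -
    have i: "integrable lborel (\<lambda>y. indicator {a..b} y * f (x - y))"
      using loc_refl[OF that] by (simp add: locally_integrable_def set_integrable_def)
    have [measurable]: "bump n a b \<in> borel_measurable borel"
      by (rule borel_measurable_continuous_onI[OF bump_regular(2)])
    have "integrable lborel (\<lambda>y. (indicator {a..b} y * f (x - y)) * bump n a b y)"
    proof (rule Bochner_Integration.integrable_bound[OF i])
      show "AE y in lborel. norm (indicator {a..b} y * f (x - y) * bump n a b y)
          \<le> norm (indicator {a..b} y * f (x - y))"
      proof (intro AE_I2)
        fix y
        have "\<bar>bump n a b y\<bar> \<le> 1"
          using bump_bounds[of n a b y] order_trans[OF _ indicator_le_1] by auto
        then show "norm (indicator {a..b} y * f (x - y) * bump n a b y)
            \<le> norm (indicator {a..b} y * f (x - y))"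
          by (simp add: abs_mult mult_left_le)
      qed
    qed (use borel_measurable_integrable[OF i] in measurable)
    moreover have "(indicator {a..b} y * f (x - y)) * bump n a b y = f (x - y) * bump n a b y" for y
      by (cases "y \<in> {a<..<b}") (simp_all add: bump_eq_0)
    ultimately show ?thesis by simp
  qed
  have locG: "locally_integrable G"
    unfolding locally_integrable_def
    by (intro allI borel_integrable_atLeastAtMost' continuous_on_subset[OF G(1)]) simp
  \<comment> \<open>Both \<open>K\<close> and \<open>G\<close>, convolved with a bump, have the derivative \<open>K' * bump\<close>.\<close>
  have const: "convolve w (bump n a b) x = convolve w (bump n a b) 0" for n a b x
  proof -
    let ?\<chi> = "bump n a b"
    have split: "convolve w ?\<chi> x = convolve K ?\<chi> x - convolve G ?\<chi> x" for x
      unfolding convolve_def w_def using w_bump[OF loc(1), of x n a b] w_bump[OF locG, of x n a b]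
      by (simp add: left_diff_distrib)
    have r: "gauss_bounded 1 ?\<chi>" "(0::real) < 1" "continuous_on UNIV ?\<chi>"
      using bump_regular by auto
    obtain C where C: "\<And>x. (LINT y|lborel. \<bar>K' (x - y) * ?\<chi> y\<bar>) \<le> C"
      using L1_plus_Linf_gauss_convolve(2)[OF K' r(3,1,2)] by blast
    have inc: "convolve w ?\<chi> x - convolve w ?\<chi> u = 0" if "u \<le> x" for u x
    proof -
      have "convolve K ?\<chi> x - convolve K ?\<chi> u = (LINT s:{u..x}|lborel. convolve K' ?\<chi> s)"
        using convolve_continuous[OF K' r(3,1,2)] that
        by (intro FTC_set_lebesgue convolve_bump_weak_derivative[OF wd K])
      moreover have "convolve G ?\<chi> x - convolve G ?\<chi> u = (LINT s:{u..x}|lborel. convolve K' ?\<chi> s)"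
        by (rule convolve_increment(1)[OF _ _ G(2) L1_plus_Linf_gauss_convolve(1)[OF K' r(3,1,2)] C w_bump[OF locG] that])
           (use borel_measurable_continuous_onI[OF r(3)] in simp_all)
      ultimately show ?thesis unfolding split by simp
    qed
    show ?thesis using inc[of 0 x] inc[of x 0] by linarith
  qed
  have "AE y in lborel. w (x - y) - w (0 - y) = 0" for x
  proof (rule bump_orthogonal_imp_AE_zero)
    show "locally_integrable (\<lambda>y. w (x - y) - w (0 - y))"
      using loc_refl[OF locw, of x] loc_refl[OF locw, of 0]
      unfolding locally_integrable_def by (auto intro!: set_integral_diff(1))
    show "(LINT y|lborel. (w (x - y) - w (0 - y)) * bump n a b y) = 0" for n a b
      using const[of n a b x] w_bump[OF locw, of x n a b] w_bump[OF locw, of 0 n a b]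
      by (simp add: left_diff_distrib convolve_def)
  qed
  then have "AE x in lborel. AE y in lborel. w (x - y) - w (0 - y) = 0" by simp
  then have "AE y in lborel. AE x in lborel. w (x - y) - w (0 - y) = 0"
    by (subst (asm) lborel_pair.AE_commute) measurable
  \<comment> \<open>By Fubini one \<open>y\<close> serves almost all shifts \<open>x\<close>, so \<open>w\<close> is almost everywhere constant.\<close>
  then obtain y where "AE x in lborel. w (x - y) - w (0 - y) = 0"
    using eventually_happens[of _ "ae_filter (lborel :: real measure)"]
    by (auto simp: ae_filter_eq_bot_iff)
  \<comment> \<open>Two reflections compose to the translation by \<open>y\<close>, which turns
    \<open>x - y\<close> into \<open>x\<close> without leaving the almost-everywhere
    statement.\<close>
  then have "AE x in lborel. w (0 - (- y - x) - y) - w (0 - y) = 0"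
    by (intro AE_reflect)
  then have "AE x in lborel. K x = G x + w (- y)" by eventually_elim (simp add: w_def)
  then show ?thesis
    using G by (intro that[of "\<lambda>x. G x + w (- y)"] continuous_intros) auto
qed

text \<open>On a unit interval the primitive varies by at most \<open>C\<close>, so its value at
  \<open>x\<close> is controlled by its average over \<open>{x..x+1}\<close>; there it agrees almost
  everywhere with \<open>K\<close>, whose average is bounded uniformly in \<open>x\<close>.\<close>

lemma weak_derivative_representation_bounded:
  assumes K: "L1_plus_Linf K k B" and K': "L1_plus_Linf K' k' B'" "locally_integrable K'"
    and G: "\<And>a x. a \<le> x \<Longrightarrow> G x - G a = (LINT s:{a..x}|lborel. K' s)"
    and ae: "AE x in lborel. K x = G x"
  shows "\<exists>C. \<forall>x. \<bar>G x\<bar> \<le> C"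
proof -
  define C where "C = (LINT y|lborel. k' y) + B'"
  have k: "integrable lborel k" "\<And>x. 0 \<le> k x" "0 \<le> B" "\<And>x. \<bar>K x\<bar> \<le> k x + B"
    using K by (auto simp: L1_plus_Linf_def)
  have B': "0 \<le> B'" using K' by (simp add: L1_plus_Linf_def)
  have "\<bar>G x\<bar> \<le> (LINT y|lborel. k y) + (B + C)" for x
  proof -
    have near: "\<bar>G x\<bar> \<le> \<bar>G s\<bar> + C" if "s \<in> {x..x+1}" for s
    proof -
      have "\<bar>G s - G x\<bar> \<le> (LINT y|lborel. k' y) + B' * (s - x)"
        using G[of x s] L1_plus_Linf_set_integral[OF K', of x s] that by auto
      also have "\<dots> \<le> C" unfolding C_def using that B' by (simp add: mult_left_le)
      finally show ?thesis by linarith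
    qed
    have "\<bar>G x\<bar> = (LINT s|lborel. \<bar>G x\<bar> * indicator {x..x+1} s)" by simp
    also have "\<dots> \<le> (LINT s|lborel. k s + (B + C) * indicator {x..x+1} s)"
    proof (rule integral_mono_AE)
      show "integrable lborel (\<lambda>s. k s + (B + C) * indicator {x..x+1} s)"
        using k(1) by (intro Bochner_Integration.integrable_add integrable_mult_right) auto
      show "AE s in lborel. \<bar>G x\<bar> * indicator {x..x+1} s \<le> k s + (B + C) * indicator {x..x+1} s"
        using ae
      proof eventually_elim
        case (elim s)
        show ?case
          using near[of s] k(4)[of s] k(2)[of s] elim by (cases "s \<in> {x..x+1}") auto
      qed
    qed (auto intro!: integrable_mult_right)
    also have "\<dots> = (LINT y|lborel. k y) + (B + C)"
      using k(1) by (subst Bochner_Integration.integral_add) (auto intro!: integrable_mult_right)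
    finally show ?thesis .
  qed
  then show ?thesis by blast
qed


section \<open>Approximate fixed points on cubes\<close>

text \<open>Kuhn's lemma supplies a small cell in which, for each coordinate, one corner is pushed
  up and another down. Uniform continuity carries both inequalities to the corner \<open>q\<close>.
  Coordinates beyond \<open>n\<close> are unconstrained, so all hypotheses concern
  \<open>i < n\<close> only.\<close>

lemma approximate_fixed_point_cube:
  fixes F :: "(nat \<Rightarrow> real) \<Rightarrow> nat \<Rightarrow> real" and n :: nat
  assumes maps: "\<And>x i. (\<And>i. i < n \<Longrightarrow> 0 \<le> x i \<and> x i \<le> 1) \<Longrightarrow> i < n \<Longrightarrow> 0 \<le> F x i \<and> F x i \<le> 1"
    and uc: "\<And>\<epsilon>::real. 0 < \<epsilon> \<Longrightarrow> \<exists>\<delta>>0. \<forall>x y. (\<forall>i<n. 0 \<le> x i \<and> x i \<le> 1) \<longrightarrow> (\<forall>i<n. 0 \<le> y i \<and> y i \<le> 1)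
        \<longrightarrow> (\<forall>i<n. \<bar>x i - y i\<bar> \<le> \<delta>) \<longrightarrow> (\<forall>i<n. \<bar>F x i - F y i\<bar> \<le> \<epsilon>)"
    and \<epsilon>: "0 < \<epsilon>"
  obtains x where "\<And>i. i < n \<Longrightarrow> 0 \<le> x i \<and> x i \<le> 1" "\<And>i. i < n \<Longrightarrow> \<bar>F x i - x i\<bar> \<le> \<epsilon>"
proof -
  obtain \<delta> where \<delta>: "\<delta> > 0" and close: "\<And>x y i. (\<forall>i<n. 0 \<le> x i \<and> x i \<le> 1) \<Longrightarrow> (\<forall>i<n. 0 \<le> y i \<and> y i \<le> 1)
      \<Longrightarrow> (\<forall>i<n. \<bar>x i - y i\<bar> \<le> \<delta>) \<Longrightarrow> i < n \<Longrightarrow> \<bar>F x i - F y i\<bar> \<le> \<epsilon> / 2"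
    using uc[of "\<epsilon> / 2"] \<epsilon> by (auto 0 3)
  obtain p0 where p0: "inverse (real (Suc p0)) < min \<delta> (\<epsilon> / 2)"
    using reals_Archimedean[of "min \<delta> (\<epsilon> / 2)"] \<delta> \<epsilon> by auto
  define p where "p = Suc p0"
  have p: "p > 0" "1 / real p \<le> \<delta>" "1 / real p \<le> \<epsilon> / 2"
    using p0 by (auto simp: p_def inverse_eq_divide)
  define sc where "sc x i = real (x i) / real p" for x :: "nat \<Rightarrow> nat" and i
  \<comment> \<open>Label 0 means that \<open>F\<close> does not decrease the coordinate, label 1
    that it does not increase it. On the faces Kuhn's lemma prescribes the labels; they keep this
    meaning because \<open>F\<close> maps the cube to itself.\<close>
  define label where "label x i =
    (if x i = 0 then 0 else if x i = p \<or> F (sc x) i < sc x i then 1 else (0::nat))" for x i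
  have cube: "\<forall>i<n. 0 \<le> sc x i \<and> sc x i \<le> 1" if "\<forall>i<n. x i \<le> p" for x
    using that p(1) by (auto simp: sc_def)
  have l0: "F (sc x) i \<ge> sc x i" if "\<forall>i<n. x i \<le> p" "i < n" "label x i = 0" for x i
    using that maps[of "sc x" i] cube[OF that(1)] by (auto simp: label_def sc_def split: if_splits)
  have l1: "F (sc x) i \<le> sc x i" if "\<forall>i<n. x i \<le> p" "i < n" "label x i \<noteq> 0" for x i
    using that maps[of "sc x" i] cube[OF that(1)] p(1) by (auto simp: label_def sc_def split: if_splits)
  obtain q where q: "\<forall>i<n. q i < p" and rs: "\<forall>i<n. \<exists>r s. (\<forall>j<n. q j \<le> r j \<and> r j \<le> q j + 1)
      \<and> (\<forall>j<n. q j \<le> s j \<and> s j \<le> q j + 1) \<and> label r i \<noteq> label s i"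
    by (rule kuhn_lemma[OF p(1), of n label]) (use p(1) in \<open>auto simp: label_def\<close>)
  have near: "\<bar>F (sc q) i - F (sc r) i\<bar> \<le> \<epsilon> / 2" "\<forall>j<n. r j \<le> p"
    "sc q i \<le> sc r i" "sc r i \<le> sc q i + \<epsilon> / 2"
    if r: "\<forall>j<n. q j \<le> r j \<and> r j \<le> q j + 1" and i: "i < n" for r i
  proof -
    show rp: "\<forall>j<n. r j \<le> p" using r q by fastforce
    have b: "sc q j \<le> sc r j \<and> sc r j \<le> sc q j + 1 / real p" if "j < n" for j
    proof -
      have "real (r j) \<le> real (q j) + 1" "real (q j) \<le> real (r j)" using r that by (auto simp flip: of_nat_Suc)
      then show ?thesis unfolding sc_def add_divide_distrib[symmetric]
        using p(1) by (auto intro: divide_right_mono)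
    qed
    then show "sc q i \<le> sc r i" "sc r i \<le> sc q i + \<epsilon> / 2" using p(3) i by force+
    have "\<forall>j<n. \<bar>sc q j - sc r j\<bar> \<le> \<delta>" using b p(2) by force
    then show "\<bar>F (sc q) i - F (sc r) i\<bar> \<le> \<epsilon> / 2"
      using q i by (intro close cube rp) (auto intro: less_imp_le)
  qed
  \<comment> \<open>Half of \<open>\<epsilon>\<close> pays for the variation of \<open>F\<close>
    between corners, the other half for the mesh size.\<close>
  have "\<bar>F (sc q) i - sc q i\<bar> \<le> \<epsilon>" if i: "i < n" for i
  proof -
    obtain r s where r: "\<forall>j<n. q j \<le> r j \<and> r j \<le> q j + 1"
      and s: "\<forall>j<n. q j \<le> s j \<and> s j \<le> q j + 1" and l: "label r i = 0" "label s i \<noteq> 0"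
      using rs i by (metis label_def)
    have "sc r i \<le> F (sc r) i" "F (sc s) i \<le> sc s i"
      using l0[OF near(2)[OF r i] i l(1)] l1[OF near(2)[OF s i] i l(2)] by simp_all
    with near(1,3,4)[OF r i] near(1,3,4)[OF s i] show ?thesis by linarith
  qed
  then show ?thesis using cube[of q] q by (intro that[of "sc q"]) (auto simp: less_imp_le)
qed

text \<open>The pointwise part of the Arzela-Ascoli theorem: diagonal extraction over the rationals,
  and the common Lipschitz constant carries the Cauchy property to every real point.\<close>

lemma lipschitz_convergent_subsequence:
  fixes v :: "nat \<Rightarrow> real \<Rightarrow> real"
  assumes bd: "\<And>k x. \<bar>v k x\<bar> \<le> b" and lip: "\<And>k x y. \<bar>v k x - v k y\<bar> \<le> L * \<bar>x - y\<bar>"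
  obtains r where "strict_mono (r :: nat \<Rightarrow> nat)" "\<And>x. convergent (\<lambda>k. v (r k) x)"
proof -
  define pt where "pt n = (of_rat (from_nat n) :: real)" for n
  define P where "P n s \<longleftrightarrow> convergent (\<lambda>k. v (s k) (pt n))" for n and s :: "nat \<Rightarrow> nat"
  interpret subseqs P
  proof
    fix n and s :: "nat \<Rightarrow> nat"
    have "bounded (range (\<lambda>k. v (s k) (pt n)))" using bd by (auto simp: bounded_iff)
    then obtain l r where "strict_mono r" "((\<lambda>k. v (s k) (pt n)) \<circ> r) \<longlonglongrightarrow> l"
      using bounded_imp_convergent_subsequence by blast
    then show "\<exists>r'. strict_mono r' \<and> P n (s \<circ> r')"
      by (auto simp: P_def o_def convergent_def)
  qed
  have "P n (s \<circ> r)" if "strict_mono r" "P n s" for r s n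
    using that LIMSEQ_subseq_LIMSEQ[of "\<lambda>k. v (s k) (pt n)" _ r] by (auto simp: P_def o_def convergent_def)
  then have diag: "P n (diagseq \<circ> ((+) (Suc n)))" for n by (rule diagseq_holds)
  \<comment> \<open>The diagonal sequence has the n-th property only from index \<open>Suc n\<close>
    on; dropping finitely many terms does not affect convergence.\<close>
  have conv: "convergent (\<lambda>k. v (diagseq k) (pt n))" for n
    using convergent_ignore_initial_segment[of "\<lambda>k. v (diagseq k) (pt n)" "Suc n"] diag[of n]
    unfolding P_def o_def add.commute[of "Suc n"] by blast
  have "Cauchy (\<lambda>k. v (diagseq k) x)" for x
  proof (rule CauchyI)
    fix e :: real assume e: "0 < e"
    have L: "0 \<le> L" using order_trans[OF abs_ge_zero lip[of 0 0 1]] by simp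
    \<comment> \<open>Using \<open>L + 1\<close> in place of \<open>L\<close> keeps the denominator
      positive when \<open>L = 0\<close>.\<close>
    obtain q where q: "q \<in> \<rat>" "x < q" "q < x + e / (3 * (L + 1))"
      using Rats_dense_in_real[of x "x + e / (3 * (L + 1))"] e L by auto
    then obtain n where n: "q = pt n"
      by (auto simp: pt_def Rats_def) (metis from_nat_to_nat)
    have "L * \<bar>x - q\<bar> \<le> (L + 1) * \<bar>x - q\<bar>" by (intro mult_right_mono) auto
    also have "\<dots> < (L + 1) * (e / (3 * (L + 1)))"
      using q L by (intro mult_strict_left_mono) auto
    also have "\<dots> = e / 3" using L by (simp add: divide_simps) 
    finally have small: "L * \<bar>x - q\<bar> < e / 3" .
    obtain M where M: "\<And>i j. i \<ge> M \<Longrightarrow> j \<ge> M \<Longrightarrow> \<bar>v (diagseq i) q - v (diagseq j) q\<bar> < e / 3"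
      using conv[of n] e CauchyD[of "\<lambda>k. v (diagseq k) q" "e / 3"] unfolding Cauchy_convergent_iff[symmetric] n
      by auto
    show "\<exists>M. \<forall>m\<ge>M. \<forall>n\<ge>M. norm (v (diagseq m) x - v (diagseq n) x) < e"
    proof (intro exI[of _ M] allI impI)
      fix i j assume "i \<ge> M" "j \<ge> M"
      with M[of i j] lip[of "diagseq i" x q] lip[of "diagseq j" x q] small
      show "norm (v (diagseq i) x - v (diagseq j) x) < e" unfolding real_norm_def by linarith
    qed
  qed
  then show ?thesis
    using subseq_diagseq by (intro that[of diagseq]) (auto simp: Cauchy_convergent_iff)
qed


section \<open>Gibbs densities\<close>

text \<open>The two potentials are kept apart: \<open>\<phi>\<close> is fixed and provides
  integrability, while \<open>u\<close> is the bounded interaction potential that varies in the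
  fixed-point problem.\<close>

definition gibbs :: "(real \<Rightarrow> real) \<Rightarrow> (real \<Rightarrow> real) \<Rightarrow> real \<Rightarrow> real" where
  "gibbs \<phi> u x = exp (- \<phi> x - u x) / (LINT y|lborel. exp (- \<phi> y - u y))"

definition bounded_Borel :: "real \<Rightarrow> (real \<Rightarrow> real) \<Rightarrow> bool" where
  "bounded_Borel b u \<longleftrightarrow> u \<in> borel_measurable borel \<and> (\<forall>x. \<bar>u x\<bar> \<le> b)"

lemma integral_positive:
  fixes f :: "real \<Rightarrow> real"
  assumes "integrable lborel f" "\<And>x. 0 < f x"
  shows "0 < (LINT x|lborel. f x)"
proof -
  have "(LINT x|lborel. f x) \<noteq> 0"
  proof
    assume "(LINT x|lborel. f x) = 0"
    then have "AE x in lborel. f x = 0"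
      using integral_nonneg_eq_0_iff_AE[OF assms(1)] assms(2) by (simp add: less_imp_le)
    then have "AE x in (lborel :: real measure). False"
      by eventually_elim (use assms(2) in \<open>metis less_irrefl\<close>)
    then show False
      using ae_filter_eq_bot_iff[of "lborel :: real measure"] by (simp add: trivial_limit_def)
  qed
  moreover have "0 \<le> (LINT x|lborel. f x)" using assms(2) by (simp add: less_imp_le)
  ultimately show ?thesis by linarith
qed

lemma convolve_bound:
  assumes [measurable]: "K \<in> borel_measurable borel" and K: "AE x in lborel. \<bar>K x\<bar> \<le> \<kappa>"
    and f: "integrable lborel f"
  shows "integrable lborel (\<lambda>y. K (x - y) * f y)"
    and "\<bar>convolve K f x\<bar> \<le> \<kappa> * (LINT y|lborel. \<bar>f y\<bar>)"
proof -
  have [measurable]: "f \<in> borel_measurable borel" using f by simp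
  have bd: "AE y in lborel. \<bar>K (x - y) * f y\<bar> \<le> \<kappa> * \<bar>f y\<bar>"
    using AE_reflect[OF K, of x] by eventually_elim (simp add: abs_mult mult_right_mono)
  have I: "integrable lborel (\<lambda>y. \<kappa> * \<bar>f y\<bar>)" using f by auto
  show int: "integrable lborel (\<lambda>y. K (x - y) * f y)"
  proof (rule Bochner_Integration.integrable_bound[OF I])
    show "AE y in lborel. norm (K (x - y) * f y) \<le> norm (\<kappa> * \<bar>f y\<bar>)"
      using bd
    proof eventually_elim
      case (elim y)
      then show ?case unfolding real_norm_def by (rule order_trans[OF _ abs_ge_self])
    qed
  qed measurable
  have "\<bar>convolve K f x\<bar> \<le> (LINT y|lborel. \<bar>K (x - y) * f y\<bar>)"
    unfolding convolve_def by (rule integral_abs_bound)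
  also have "\<dots> \<le> (LINT y|lborel. \<kappa> * \<bar>f y\<bar>)"
    using int I bd by (intro integral_mono_AE) auto
  finally show "\<bar>convolve K f x\<bar> \<le> \<kappa> * (LINT y|lborel. \<bar>f y\<bar>)" by simp
qed

lemma bounded_Borel_limit:
  assumes "\<And>n. bounded_Borel b (u n)" "\<And>x. (\<lambda>n. u n x) \<longlonglongrightarrow> v x"
  shows "bounded_Borel b v"
proof -
  have "v \<in> borel_measurable borel"
    by (rule borel_measurable_LIMSEQ_real[of _ u]) (use assms in \<open>auto simp: bounded_Borel_def\<close>)
  moreover have "\<bar>v x\<bar> \<le> b" for x
    by (rule LIMSEQ_le_const2[OF tendsto_rabs[OF assms(2)]]) (use assms(1) in \<open>auto simp: bounded_Borel_def\<close>)
  ultimately show ?thesis by (simp add: bounded_Borel_def)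
qed

locale confinement =
  fixes \<phi> :: "real \<Rightarrow> real"
  assumes measurable_confinement [measurable]: "\<phi> \<in> borel_measurable borel"
    and integrable_confinement: "integrable lborel (\<lambda>x. exp (- \<phi> x))"
begin

section \<open>Estimates uniform over a ball of potentials\<close>

lemma gibbs_weight:
  assumes u: "bounded_Borel b u"
  shows "exp (- \<phi> x - u x) \<le> exp b * exp (- \<phi> x)"
    and "exp (- b) * exp (- \<phi> x) \<le> exp (- \<phi> x - u x)"
    and "integrable lborel (\<lambda>x. exp (- \<phi> x - u x))"
    and "0 < (LINT y|lborel. exp (- \<phi> y - u y))"
    and "exp (- b) * (LINT y|lborel. exp (- \<phi> y)) \<le> (LINT y|lborel. exp (- \<phi> y - u y))"
proof -
  have [measurable]: "u \<in> borel_measurable borel" and b: "\<And>x. \<bar>u x\<bar> \<le> b"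
    using u by (auto simp: bounded_Borel_def)
  have le: "exp (- \<phi> x - u x) \<le> exp b * exp (- \<phi> x)" "exp (- b) * exp (- \<phi> x) \<le> exp (- \<phi> x - u x)" for x
    using b[of x] unfolding exp_add[symmetric] by auto
  then show "exp (- \<phi> x - u x) \<le> exp b * exp (- \<phi> x)" "exp (- b) * exp (- \<phi> x) \<le> exp (- \<phi> x - u x)"
    by auto
  have I: "integrable lborel (\<lambda>x. exp b * exp (- \<phi> x))" "integrable lborel (\<lambda>x. exp (- b) * exp (- \<phi> x))"
    using integrable_confinement by (auto intro: integrable_mult_right)
  show int: "integrable lborel (\<lambda>x. exp (- \<phi> x - u x))"
    by (rule Bochner_Integration.integrable_bound[OF I(1)]) (use le in auto)
  then show "0 < (LINT y|lborel. exp (- \<phi> y - u y))"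
    by (rule integral_positive) simp
  have "(LINT y|lborel. exp (- b) * exp (- \<phi> y)) \<le> (LINT y|lborel. exp (- \<phi> y - u y))"
    using I(2) int le(2) by (rule integral_mono)
  then show "exp (- b) * (LINT y|lborel. exp (- \<phi> y)) \<le> (LINT y|lborel. exp (- \<phi> y - u y))" by simp
qed

lemma gibbs_density:
  assumes u: "bounded_Borel b u"
  shows "0 < gibbs \<phi> u x" and "integrable lborel (gibbs \<phi> u)"
    and "(LINT x|lborel. gibbs \<phi> u x) = 1" and "(LINT x|lborel. \<bar>gibbs \<phi> u x\<bar>) = 1"
proof -
  note w = gibbs_weight[OF u]
  show pos: "0 < gibbs \<phi> u x" for x unfolding gibbs_def using w(4) by simp
  show "integrable lborel (gibbs \<phi> u)"
    unfolding gibbs_def using w(3) by (intro integrable_divide)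
  show one: "(LINT x|lborel. gibbs \<phi> u x) = 1" unfolding gibbs_def using w(4) by simp
  show "(LINT x|lborel. \<bar>gibbs \<phi> u x\<bar>) = 1" using one pos by (simp add: less_imp_le)
qed

text \<open>One factor \<open>exp b\<close> comes from the weight and one from the normalising
  integral. The bound is independent of \<open>u\<close>, which makes it the common majorant for
  dominated convergence.\<close>

lemma gibbs_le:
  assumes u: "bounded_Borel b u"
  shows "gibbs \<phi> u x \<le> exp (2 * b) / (LINT y|lborel. exp (- \<phi> y)) * exp (- \<phi> x)"
proof -
  have Z: "0 < (LINT y|lborel. exp (- \<phi> y))"
    by (rule integral_positive[OF integrable_confinement]) simp
  have "gibbs \<phi> u x \<le> (exp b * exp (- \<phi> x)) / (exp (- b) * (LINT y|lborel. exp (- \<phi> y)))"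
    unfolding gibbs_def using gibbs_weight[OF u] Z by (intro frac_le) auto
  also have "\<dots> = exp (2 * b) / (LINT y|lborel. exp (- \<phi> y)) * exp (- \<phi> x)"
    using Z exp_add[of b b] by (simp add: exp_minus field_simps)
  finally show ?thesis .
qed

lemma gibbs_ratio:
  assumes u: "bounded_Borel b u" and u': "bounded_Borel b u'" and t: "\<And>x. \<bar>u x - u' x\<bar> \<le> t"
  shows "gibbs \<phi> u' x \<le> exp (2 * t) * gibbs \<phi> u x"
proof -
  have e: "exp (- \<phi> x - v x) \<le> exp t * exp (- \<phi> x - v' x)" if "\<And>x. \<bar>v x - v' x\<bar> \<le> t" for x v v'
    using that[of x] unfolding exp_add[symmetric] by auto
  have Z: "(LINT y|lborel. exp (- \<phi> y - u y)) \<le> exp t * (LINT y|lborel. exp (- \<phi> y - u' y))"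
    unfolding integral_mult_right_zero[symmetric]
    using gibbs_weight(3)[OF u] gibbs_weight(3)[OF u'] e[of u u'] t by (intro integral_mono) auto
  have "gibbs \<phi> u' x \<le> (exp t * exp (- \<phi> x - u x)) / ((LINT y|lborel. exp (- \<phi> y - u y)) / exp t)"
    unfolding gibbs_def using e[of u' u x] t Z gibbs_weight(4)[OF u]
    by (intro frac_le) (auto simp: abs_minus_commute divide_le_eq mult.commute)
  also have "\<dots> = exp (2 * t) * gibbs \<phi> u x"
    unfolding gibbs_def using exp_add[of t t] by simp
  finally show ?thesis .
qed

text \<open>The ratio bound holds in both directions, which gives a pointwise bound relative to
  \<open>gibbs \<phi> u\<close>; the total mass 1 then turns it into a bound free of
  \<open>u\<close>.\<close>

lemma gibbs_L1_stability:
  assumes u: "bounded_Borel b u" and u': "bounded_Borel b u'" and t: "\<And>x. \<bar>u x - u' x\<bar> \<le> t"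
  shows "(LINT x|lborel. \<bar>gibbs \<phi> u x - gibbs \<phi> u' x\<bar>) \<le> exp (2 * t) - 1"
proof -
  have "\<bar>gibbs \<phi> u x - gibbs \<phi> u' x\<bar> \<le> (exp (2 * t) - 1) * gibbs \<phi> u x" for x
  proof -
    let ?g = "gibbs \<phi> u x" and ?g' = "gibbs \<phi> u' x" and ?e = "exp (2 * t)"
    have g: "?g' \<le> ?e * ?g" "?g \<le> ?e * ?g'" "0 < ?g"
      using gibbs_ratio[OF u u' t] gibbs_ratio[OF u' u] t gibbs_density(1)[OF u]
      by (auto simp: abs_minus_commute)
    \<comment> \<open>Equivalent to \<open>1 - 1 / ?e \<le> ?e - 1\<close>: the lower deviation is
      no larger than the upper one.\<close>
    have "1 / ?e + ?e \<ge> 2"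
      using zero_le_power2[of "?e - 1"] by (simp add: field_simps power2_eq_square)
    then have "2 * ?g \<le> (1 / ?e + ?e) * ?g" using g by (intro mult_right_mono) auto
    moreover have "?g / ?e \<le> ?g'" using g(2) by (simp add: divide_le_eq mult.commute)
    ultimately show ?thesis using g(1) by (simp add: algebra_simps abs_le_iff)
  qed
  then have "(LINT x|lborel. \<bar>gibbs \<phi> u x - gibbs \<phi> u' x\<bar>) \<le> (LINT x|lborel. (exp (2 * t) - 1) * gibbs \<phi> u x)"
    using gibbs_density(2)[OF u] gibbs_density(2)[OF u'] by (intro integral_mono) auto
  then show ?thesis using gibbs_density(3)[OF u] by simp
qed

lemma convolve_gibbs_stability:
  assumes K: "K \<in> borel_measurable borel" "AE x in lborel. \<bar>K x\<bar> \<le> \<kappa>"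
    and u: "bounded_Borel b u" and u': "bounded_Borel b u'" and t: "\<And>x. \<bar>u x - u' x\<bar> \<le> t"
  shows "\<bar>convolve K (gibbs \<phi> u) x - convolve K (gibbs \<phi> u') x\<bar> \<le> \<kappa> * (exp (2 * t) - 1)"
proof -
  note i = gibbs_density(2)[OF u] gibbs_density(2)[OF u']
  have "0 \<le> \<kappa>"
  proof -
    obtain x where "\<bar>K x\<bar> \<le> \<kappa>"
      using K(2) eventually_happens[of _ "ae_filter (lborel :: real measure)"]
      by (auto simp: ae_filter_eq_bot_iff)
    then show ?thesis by linarith
  qed
  have "convolve K (gibbs \<phi> u) x - convolve K (gibbs \<phi> u') x = convolve K (\<lambda>y. gibbs \<phi> u y - gibbs \<phi> u' y) x"
    unfolding convolve_def using convolve_bound(1)[OF K i(1), of x] convolve_bound(1)[OF K i(2), of x]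
    by (simp add: right_diff_distrib)
  also have "\<bar>\<dots>\<bar> \<le> \<kappa> * (LINT y|lborel. \<bar>gibbs \<phi> u y - gibbs \<phi> u' y\<bar>)"
    using i by (intro convolve_bound(2)[OF K]) auto
  also have "\<dots> \<le> \<kappa> * (exp (2 * t) - 1)"
    using gibbs_L1_stability[OF u u' t] \<open>0 \<le> \<kappa>\<close> by (rule mult_left_mono)
  finally show ?thesis .
qed

text \<open>Pointwise convergence of the potentials is all that the limiting arguments provide.
  Dominated convergence is used twice, for the normalising integral and then for the
  convolution.\<close>

lemma convolve_gibbs_continuous:
  assumes K [measurable]: "K \<in> borel_measurable borel" and K': "AE x in lborel. \<bar>K x\<bar> \<le> \<kappa>"
    and u: "\<And>n. bounded_Borel b (u n)" and lim: "\<And>x. (\<lambda>n. u n x) \<longlonglongrightarrow> v x"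
  shows "(\<lambda>n. convolve K (gibbs \<phi> (u n)) x) \<longlonglongrightarrow> convolve K (gibbs \<phi> v) x"
proof -
  have v: "bounded_Borel b v" by (rule bounded_Borel_limit[OF u lim])
  have [measurable]: "u n \<in> borel_measurable borel" "v \<in> borel_measurable borel" for n
    using u v by (auto simp: bounded_Borel_def)
  have "(\<lambda>n. LINT y|lborel. exp (- \<phi> y - u n y)) \<longlonglongrightarrow> (LINT y|lborel. exp (- \<phi> y - v y))"
  proof (rule integral_dominated_convergence[where w = "\<lambda>y. exp b * exp (- \<phi> y)"])
    show "integrable lborel (\<lambda>y. exp b * exp (- \<phi> y))"
      using integrable_confinement by (rule integrable_mult_right)
    show "AE y in lborel. (\<lambda>n. exp (- \<phi> y - u n y)) \<longlonglongrightarrow> exp (- \<phi> y - v y)"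
      by (intro AE_I2 tendsto_intros lim)
    show "AE y in lborel. norm (exp (- \<phi> y - u n y)) \<le> exp b * exp (- \<phi> y)" for n
      using gibbs_weight(1)[OF u] by simp
  qed measurable
  then have g: "(\<lambda>n. gibbs \<phi> (u n) y) \<longlonglongrightarrow> gibbs \<phi> v y" for y
    unfolding gibbs_def using gibbs_weight(4)[OF v] by (intro tendsto_intros lim) auto
  define c where "c = exp (2 * b) / (LINT y|lborel. exp (- \<phi> y))"
  have "(\<lambda>n. LINT y|lborel. K (x - y) * gibbs \<phi> (u n) y) \<longlonglongrightarrow> (LINT y|lborel. K (x - y) * gibbs \<phi> v y)"
  proof (rule integral_dominated_convergence[where w = "\<lambda>y. \<kappa> * (c * exp (- \<phi> y))"])
    have [measurable]: "gibbs \<phi> (u n) \<in> borel_measurable borel" "gibbs \<phi> v \<in> borel_measurable borel" for n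
      using gibbs_density(2)[OF u] gibbs_density(2)[OF v] by (auto dest: borel_measurable_integrable)
    show "(\<lambda>y. K (x - y) * gibbs \<phi> (u n) y) \<in> borel_measurable lborel"
      "(\<lambda>y. K (x - y) * gibbs \<phi> v y) \<in> borel_measurable lborel" for n by measurable
    show "integrable lborel (\<lambda>y. \<kappa> * (c * exp (- \<phi> y)))"
      using integrable_confinement by (intro integrable_mult_right)
    show "AE y in lborel. (\<lambda>n. K (x - y) * gibbs \<phi> (u n) y) \<longlonglongrightarrow> K (x - y) * gibbs \<phi> v y"
      by (intro AE_I2 tendsto_intros g)
    show "AE y in lborel. norm (K (x - y) * gibbs \<phi> (u n) y) \<le> \<kappa> * (c * exp (- \<phi> y))" for n
      using AE_reflect[OF K', of x]
    proof eventually_elim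
      case (elim y)
      have "\<bar>K (x - y)\<bar> * \<bar>gibbs \<phi> (u n) y\<bar> \<le> \<kappa> * (c * exp (- \<phi> y))"
        using elim gibbs_le[OF u, of n y] gibbs_density(1)[OF u, of n y]
        by (intro mult_mono) (auto simp: c_def)
      then show ?case by (simp add: abs_mult)
    qed
  qed
  then show ?thesis by (simp add: convolve_def)
qed

lemma bounded_Borel_convolve_gibbs:
  assumes K: "K \<in> borel_measurable borel" "AE x in lborel. \<bar>K x\<bar> \<le> \<kappa>"
    and u: "bounded_Borel b u" and c: "0 \<le> c" "c * \<kappa> \<le> b'"
  shows "bounded_Borel b' (\<lambda>x. c * convolve K (gibbs \<phi> u) x)"
proof -
  note i = gibbs_density(2)[OF u]
  have [measurable]: "convolve K (gibbs \<phi> u) \<in> borel_measurable borel"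
    using K(1) i by (intro convolve_measurable) (auto dest: borel_measurable_integrable)
  have "\<bar>c * convolve K (gibbs \<phi> u) x\<bar> \<le> b'" for x
  proof -
    have "c * \<bar>convolve K (gibbs \<phi> u) x\<bar> \<le> c * \<kappa>"
      using convolve_bound(2)[OF K i, of x] gibbs_density(4)[OF u] c by (intro mult_left_mono) auto
    then show ?thesis using c by (simp add: abs_mult)
  qed
  then show ?thesis by (simp add: bounded_Borel_def)
qed

end


section \<open>Self-consistent Gibbs densities\<close>

text \<open>There are \<open>2 * k * k\<close> cells of length \<open>1 / k\<close>, covering
  \<open>[-k, k)\<close>, and cell \<open>j\<close> starts at \<open>j / k - k\<close>. Coordinates
  in \<open>[0, 1]\<close> are rescaled to values in \<open>[-b, b]\<close>, so the unit cube
  parametrises potentials in the ball.\<close>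

definition step_function :: "nat \<Rightarrow> real \<Rightarrow> (nat \<Rightarrow> real) \<Rightarrow> real \<Rightarrow> real" where
  "step_function k b a x =
     (if - real k \<le> x \<and> x < real k then b * (2 * a (nat \<lfloor>(x + real k) * real k\<rfloor>) - 1) else 0)"

lemma step_function_node:
  assumes "- real k \<le> x" "x < real k"
  obtains j where "j < 2 * k * k" "\<bar>x - (real j / real k - real k)\<bar> \<le> 1 / real k"
    "\<And>b a. step_function k b a x = b * (2 * a j - 1)"
proof -
  have k: "0 < real k" using assms by linarith
  define z where "z = (x + real k) * real k"
  define j where "j = nat \<lfloor>z\<rfloor>"
  have z0: "0 \<le> z" using assms k by (simp add: z_def)
  then have j: "real j \<le> z" "z < real j + 1" by (simp_all add: j_def)
  have "z < (2 * real k) * real k"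
    unfolding z_def using assms k by (intro mult_strict_right_mono) auto
  with j have "real j < real (2 * k * k)" by simp
  then have "j < 2 * k * k" by (simp only: of_nat_less_iff)
  moreover have "x = z / real k - real k" using k by (simp add: z_def)
  then have "x - (real j / real k - real k) = (z - real j) / real k" by (simp add: diff_divide_distrib)
  then have "\<bar>x - (real j / real k - real k)\<bar> \<le> 1 / real k"
    using j k by (simp add: divide_right_mono)
  moreover have "step_function k b a x = b * (2 * a j - 1)" for b a
    using assms by (simp add: step_function_def j_def z_def)
  ultimately show ?thesis by (rule that)
qed

lemma step_function_bounded_Borel:
  assumes a: "\<And>i. i < 2 * k * k \<Longrightarrow> 0 \<le> a i \<and> a i \<le> 1" and b: "0 \<le> b"
  shows "bounded_Borel b (step_function k b a)"
proof -
  have "step_function k b a \<in> borel_measurable borel"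
    unfolding step_function_def by measurable
  moreover have "\<bar>step_function k b a x\<bar> \<le> b" for x
  proof (cases "- real k \<le> x \<and> x < real k")
    case True
    then obtain j where j: "j < 2 * k * k" "step_function k b a x = b * (2 * a j - 1)"
      using step_function_node by metis
    have "b * \<bar>2 * a j - 1\<bar> \<le> b * 1" using a[OF j(1)] b by (intro mult_left_mono) auto
    then show ?thesis using j(2) b by (simp add: abs_mult)
  qed (use b in \<open>auto simp: step_function_def\<close>)
  ultimately show ?thesis by (simp add: bounded_Borel_def)
qed

lemma exp_minus_one_le:
  assumes "0 \<le> x" "x \<le> 1"
  shows "exp x - 1 \<le> 2 * (x :: real)"
proof -
  have "x\<^sup>2 \<le> x" using assms by (simp add: power2_eq_square mult_left_le)
  then show ?thesis using exp_bound[OF assms] by linarith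
qed

context confinement
begin

text \<open>Cell values are mapped to the new potential sampled at left cell ends. The error
  consists of the variation within a cell, \<open>L / k\<close>, and the cube error
  \<open>1 / k\<close> rescaled by \<open>2 * b\<close>.\<close>

lemma approximate_gibbs_fixed_point:
  assumes K: "K \<in> borel_measurable borel" "AE x in lborel. \<bar>K x\<bar> \<le> \<kappa>"
    and c: "0 \<le> c" "c * \<kappa> \<le> b" and b: "0 < b" and k: "0 < k"
    and lip: "\<And>u x y. bounded_Borel b u \<Longrightarrow>
      \<bar>c * convolve K (gibbs \<phi> u) x - c * convolve K (gibbs \<phi> u) y\<bar> \<le> L * \<bar>x - y\<bar>"
  shows "\<exists>u. bounded_Borel b u \<and>
    (\<forall>x. - real k \<le> x \<and> x < real k \<longrightarrow> \<bar>c * convolve K (gibbs \<phi> u) x - u x\<bar> \<le> (L + 2 * b) / real k)"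
proof -
  define n where "n = 2 * k * k"
  define \<Psi> where "\<Psi> u x = c * convolve K (gibbs \<phi> u) x" for u x
  \<comment> \<open>Sampling at the left end of cell \<open>i\<close>, followed by the affine map
    from \<open>[-b, b]\<close> to \<open>[0, 1]\<close>.\<close>
  define F where "F a i = (\<Psi> (step_function k b a) (real i / real k - real k) / b + 1) / 2" for a i
  have st: "bounded_Borel b (step_function k b a)" if "\<And>i. i < n \<Longrightarrow> 0 \<le> a i \<and> a i \<le> 1" for a
    using that b by (intro step_function_bounded_Borel) (auto simp: n_def)
  have \<Psi>: "\<bar>\<Psi> u x\<bar> \<le> b" if "bounded_Borel b u" for u x
    using bounded_Borel_convolve_gibbs[OF K that c] by (simp add: bounded_Borel_def \<Psi>_def)
  obtain a where a: "\<And>i. i < n \<Longrightarrow> 0 \<le> a i \<and> a i \<le> 1" "\<And>i. i < n \<Longrightarrow> \<bar>F a i - a i\<bar> \<le> 1 / real k"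
  proof (rule approximate_fixed_point_cube[of n F "1 / real k"])
    fix a :: "nat \<Rightarrow> real" and i assume "\<And>i. i < n \<Longrightarrow> 0 \<le> a i \<and> a i \<le> 1"
    then have "bounded_Borel b (step_function k b a)" by (rule st)
    from \<Psi>[OF this, of "real i / real k - real k"] b
    show "0 \<le> F a i \<and> F a i \<le> 1"
      by (auto simp: F_def abs_le_iff field_simps)
  next
    fix \<epsilon> :: real assume \<epsilon>: "0 < \<epsilon>"
    \<comment> \<open>Coordinates that are \<open>\<delta>\<close>-close give potentials within
      \<open>2 * b * \<delta>\<close>. The choice makes the stability factor
      \<open>exp (4 * b * \<delta>) - 1\<close> equal to \<open>2 * \<epsilon>\<close>, and the
      rescaling by \<open>2 * b\<close> leaves \<open>\<epsilon>\<close>.\<close>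
    define \<delta> where "\<delta> = ln (1 + 2 * \<epsilon>) / (4 * b)"
    have \<delta>: "\<delta> > 0" "exp (4 * b * \<delta>) - 1 = 2 * \<epsilon>" using \<epsilon> b by (simp_all add: \<delta>_def)
    have "\<bar>F x i - F y i\<bar> \<le> \<epsilon>"
      if x: "\<forall>i<n. 0 \<le> x i \<and> x i \<le> 1" and y: "\<forall>i<n. 0 \<le> y i \<and> y i \<le> 1"
        and xy: "\<forall>i<n. \<bar>x i - y i\<bar> \<le> \<delta>" for x y i
    proof -
      have "\<bar>step_function k b x z - step_function k b y z\<bar> \<le> 2 * b * \<delta>" for z
      proof (cases "- real k \<le> z \<and> z < real k")
        case True
        then obtain j where j: "j < 2 * k * k" "\<And>a. step_function k b a z = b * (2 * a j - 1)"
          using step_function_node by metis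
        have "b * \<bar>x j - y j\<bar> \<le> b * \<delta>" using xy j(1) b by (intro mult_left_mono) (auto simp: n_def)
        moreover have "step_function k b x z - step_function k b y z = 2 * (b * (x j - y j))"
          unfolding j(2) by (simp add: algebra_simps)
        ultimately show ?thesis using b by (simp add: abs_mult)
      next
        case False
        then show ?thesis using b \<delta>(1) by (auto simp: step_function_def)
      qed
      from convolve_gibbs_stability[where x = "real i / real k - real k", OF K st st this] x y
      have "\<bar>convolve K (gibbs \<phi> (step_function k b x)) (real i / real k - real k)
          - convolve K (gibbs \<phi> (step_function k b y)) (real i / real k - real k)\<bar> \<le> \<kappa> * (2 * \<epsilon>)"
        using \<delta>(2) by (simp add: mult.assoc)
      from mult_left_mono[OF this c(1)]
      have "\<bar>\<Psi> (step_function k b x) (real i / real k - real k)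
          - \<Psi> (step_function k b y) (real i / real k - real k)\<bar> \<le> c * \<kappa> * (2 * \<epsilon>)"
        using c(1) by (simp add: \<Psi>_def right_diff_distrib[symmetric] abs_mult mult.assoc)
      also have "\<dots> \<le> b * (2 * \<epsilon>)" using c(2) \<epsilon> by (intro mult_right_mono) auto
      finally have "\<bar>\<Psi> (step_function k b x) (real i / real k - real k)
          - \<Psi> (step_function k b y) (real i / real k - real k)\<bar> \<le> b * (2 * \<epsilon>)" .
      moreover have "F x i - F y i = (\<Psi> (step_function k b x) (real i / real k - real k)
          - \<Psi> (step_function k b y) (real i / real k - real k)) / (2 * b)"
        using b by (simp add: F_def field_simps)
      ultimately show ?thesis using b by (simp add: divide_le_eq mult_ac)
    qed
    then show "\<exists>\<delta>>0. \<forall>x y. (\<forall>i<n. 0 \<le> x i \<and> x i \<le> 1) \<longrightarrow> (\<forall>i<n. 0 \<le> y i \<and> y i \<le> 1)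
        \<longrightarrow> (\<forall>i<n. \<bar>x i - y i\<bar> \<le> \<delta>) \<longrightarrow> (\<forall>i<n. \<bar>F x i - F y i\<bar> \<le> \<epsilon>)"
      using \<delta>(1) by blast
  qed (use k in auto)
  let ?u = "step_function k b a"
  have u: "bounded_Borel b ?u" by (rule st[OF a(1)])
  have "\<bar>\<Psi> ?u x - ?u x\<bar> \<le> (L + 2 * b) / real k" if x: "- real k \<le> x" "x < real k" for x
  proof -
    obtain j where j: "j < 2 * k * k" "\<bar>x - (real j / real k - real k)\<bar> \<le> 1 / real k"
      "?u x = b * (2 * a j - 1)"
      using step_function_node[OF x] by metis
    let ?y = "real j / real k - real k"
    have L: "0 \<le> L" using order_trans[OF abs_ge_zero lip[OF u, of 0 1]] by simp
    have "\<bar>\<Psi> ?u x - \<Psi> ?u ?y\<bar> \<le> L * \<bar>x - ?y\<bar>" using lip[OF u] by (simp add: \<Psi>_def)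
    also have "\<dots> \<le> L * (1 / real k)" using j(2) L by (rule mult_left_mono)
    finally have 1: "\<bar>\<Psi> ?u x - \<Psi> ?u ?y\<bar> \<le> L * (1 / real k)" .
    have "\<Psi> ?u ?y - b * (2 * a j - 1) = 2 * b * (F a j - a j)"
      using b by (simp add: F_def field_simps)
    moreover have "\<bar>2 * b * (F a j - a j)\<bar> \<le> 2 * b * (1 / real k)"
      using a(2)[of j] j(1) b unfolding abs_mult by (intro mult_mono) (auto simp: n_def)
    ultimately have "\<bar>\<Psi> ?u ?y - ?u x\<bar> \<le> 2 * b * (1 / real k)" using j(3) by simp
    with 1 have "\<bar>\<Psi> ?u x - ?u x\<bar> \<le> L * (1 / real k) + 2 * b * (1 / real k)" by linarith
    then show ?thesis by (simp add: add_divide_distrib)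
  qed
  with u show ?thesis unfolding \<Psi>_def by blast
qed

lemma gibbs_fixed_point_exists:
  assumes K: "K \<in> borel_measurable borel" "AE x in lborel. \<bar>K x\<bar> \<le> \<kappa>"
    and c: "0 \<le> c" "c * \<kappa> \<le> b" and b: "0 < b"
    and lip: "\<And>u x y. bounded_Borel b u \<Longrightarrow>
      \<bar>c * convolve K (gibbs \<phi> u) x - c * convolve K (gibbs \<phi> u) y\<bar> \<le> L * \<bar>x - y\<bar>"
  shows "\<exists>u. bounded_Borel b u \<and> u = (\<lambda>x. c * convolve K (gibbs \<phi> u) x)"
proof -
  define \<Psi> where "\<Psi> u x = c * convolve K (gibbs \<phi> u) x" for u x
  \<comment> \<open>The shift to \<open>Suc k\<close> excludes the empty grid and a zero
    denominator.\<close>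
  have "\<forall>k. \<exists>u. bounded_Borel b u \<and> (\<forall>x. - real (Suc k) \<le> x \<and> x < real (Suc k) \<longrightarrow>
      \<bar>\<Psi> u x - u x\<bar> \<le> (L + 2 * b) / real (Suc k))"
    unfolding \<Psi>_def using approximate_gibbs_fixed_point[OF K c b _ lip] by blast
  then obtain u where u: "\<And>k. bounded_Borel b (u k)"
    and approx: "\<And>k x. - real (Suc k) \<le> x \<Longrightarrow> x < real (Suc k) \<Longrightarrow>
      \<bar>\<Psi> (u k) x - u k x\<bar> \<le> (L + 2 * b) / real (Suc k)"
    by metis
  have \<Psi>: "bounded_Borel b (\<Psi> v)" if "bounded_Borel b v" for v
    using bounded_Borel_convolve_gibbs[OF K that c] by (simp add: \<Psi>_def[abs_def])
  \<comment> \<open>The subsequence is extracted from the images: they share a Lipschitz constant,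
    which the step functions do not. At each fixed point of the line the vanishing error then passes
    the limit on to \<open>u (r k)\<close>.\<close>
  obtain r where r: "strict_mono (r :: nat \<Rightarrow> nat)" "\<And>x. convergent (\<lambda>k. \<Psi> (u (r k)) x)"
  proof (rule lipschitz_convergent_subsequence[of "\<lambda>k. \<Psi> (u k)" b L])
    show "\<bar>\<Psi> (u k) x\<bar> \<le> b" for k x using \<Psi>[OF u] by (simp add: bounded_Borel_def)
    show "\<bar>\<Psi> (u k) x - \<Psi> (u k) y\<bar> \<le> L * \<bar>x - y\<bar>" for k x y unfolding \<Psi>_def by (rule lip[OF u])
  qed blast
  define v where "v x = lim (\<lambda>k. \<Psi> (u (r k)) x)" for x
  have lim: "(\<lambda>k. \<Psi> (u (r k)) x) \<longlonglongrightarrow> v x" for x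
    using r(2) by (simp add: v_def convergent_LIMSEQ_iff)
  have lim_u: "(\<lambda>k. u (r k) x) \<longlonglongrightarrow> v x" for x
  proof -
    have "(\<lambda>k. (L + 2 * b) * inverse (real (Suc (r k)))) \<longlonglongrightarrow> (L + 2 * b) * 0"
      by (intro tendsto_mult tendsto_const
        LIMSEQ_subseq_LIMSEQ[OF LIMSEQ_inverse_real_of_nat r(1), unfolded o_def])
    then have small: "(\<lambda>k. (L + 2 * b) / real (Suc (r k))) \<longlonglongrightarrow> 0"
      by (simp add: divide_inverse)
    have "\<forall>\<^sub>F k in sequentially. \<bar>x\<bar> < real (Suc (r k))"
    proof (rule eventually_sequentiallyI)
      fix k assume "nat \<lceil>\<bar>x\<bar>\<rceil> \<le> k"
      then have "\<bar>x\<bar> \<le> real k" by linarith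
      also have "\<dots> \<le> real (r k)" using seq_suble[OF r(1)] by simp
      finally show "\<bar>x\<bar> < real (Suc (r k))" by simp
    qed
    then have "\<forall>\<^sub>F k in sequentially. norm (\<Psi> (u (r k)) x - u (r k) x) \<le> (L + 2 * b) / real (Suc (r k))"
    proof eventually_elim
      case (elim k)
      then show ?case using approx[of "r k" x] by (simp add: abs_less_iff minus_less_iff less_imp_le)
    qed
    then have "(\<lambda>k. \<Psi> (u (r k)) x - u (r k) x) \<longlonglongrightarrow> 0"
      using small by (rule Lim_null_comparison)
    from tendsto_diff[OF lim[of x] this] show ?thesis by simp
  qed
  have v: "bounded_Borel b v" by (rule bounded_Borel_limit[OF u lim_u])
  have "(\<lambda>k. \<Psi> (u (r k)) x) \<longlonglongrightarrow> \<Psi> v x" for x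
    unfolding \<Psi>_def by (intro tendsto_mult tendsto_const convolve_gibbs_continuous[OF K u lim_u])
  then have "v x = \<Psi> v x" for x using LIMSEQ_unique lim by blast
  with v show ?thesis unfolding \<Psi>_def by (intro exI[of _ v]) auto
qed

text \<open>The origin of the threshold constant: \<open>2 * t \<le> 1\<close> gives
  \<open>exp (2 * t) - 1 \<le> 4 * t\<close>, and \<open>1 / 8\<close> times this is
  \<open>t / 2\<close>. The restriction \<open>t \<le> 1 / 4\<close> holds for any two potentials
  bounded by \<open>1 / 8\<close>.\<close>

lemma gibbs_contraction:
  assumes K: "K \<in> borel_measurable borel" "AE x in lborel. \<bar>K x\<bar> \<le> \<kappa>"
    and c: "0 \<le> c" "c * \<kappa> \<le> 1 / 8"
    and u: "bounded_Borel (1 / 8) u" and u': "bounded_Borel (1 / 8) u'"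
    and t: "\<And>x. \<bar>u x - u' x\<bar> \<le> t" "t \<le> 1 / 4"
  shows "\<bar>c * convolve K (gibbs \<phi> u) x - c * convolve K (gibbs \<phi> u') x\<bar> \<le> t / 2"
proof -
  have t0: "0 \<le> t" using order_trans[OF abs_ge_zero t(1)] .
  have "\<bar>c * convolve K (gibbs \<phi> u) x - c * convolve K (gibbs \<phi> u') x\<bar>
      = c * \<bar>convolve K (gibbs \<phi> u) x - convolve K (gibbs \<phi> u') x\<bar>"
    using c(1) by (simp add: right_diff_distrib[symmetric] abs_mult)
  also have "\<dots> \<le> c * (\<kappa> * (exp (2 * t) - 1))"
    using convolve_gibbs_stability[OF K u u' t(1)] c(1) by (rule mult_left_mono)
  also have "\<dots> = (c * \<kappa>) * (exp (2 * t) - 1)" by simp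
  also have "\<dots> \<le> 1 / 8 * (4 * t)"
    using exp_minus_one_le[of "2 * t"] t(2) t0 c(2) by (intro mult_mono) auto
  finally show ?thesis by simp
qed

text \<open>Picard iteration from zero; the increments are dominated by a geometric series uniformly
  in \<open>x\<close>. Convergence is only recorded pointwise, which
  \<open>convolve_gibbs_continuous\<close> accepts.\<close>

lemma gibbs_small_fixed_point_exists:
  assumes K: "K \<in> borel_measurable borel" "AE x in lborel. \<bar>K x\<bar> \<le> \<kappa>"
    and c: "0 \<le> c" "c * \<kappa> \<le> 1 / 8"
  shows "\<exists>u. bounded_Borel (1 / 8) u \<and> u = (\<lambda>x. c * convolve K (gibbs \<phi> u) x)"
proof -
  define \<Psi> where "\<Psi> u = (\<lambda>x. c * convolve K (gibbs \<phi> u) x)" for u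
  define u where "u n = (\<Psi> ^^ n) (\<lambda>_. 0)" for n
  have u: "bounded_Borel (1 / 8) (u n)" for n
  proof (induction n)
    case (Suc n)
    have "bounded_Borel (1 / 8) (\<Psi> (u n))"
      unfolding \<Psi>_def by (rule bounded_Borel_convolve_gibbs[OF K Suc c])
    then show ?case by (simp add: u_def)
  qed (simp add: u_def bounded_Borel_def)
  have step: "\<bar>u (Suc n) x - u n x\<bar> \<le> 1 / 4 * (1 / 2) ^ n" for n x
  proof (induction n arbitrary: x)
    case 0
    have "\<bar>u 1 x\<bar> \<le> 1 / 8" using u[of 1] by (simp add: bounded_Borel_def)
    then have "\<bar>u 1 x\<bar> \<le> 1 / 4" by linarith
    then show ?case by (simp add: u_def)
  next
    case (Suc n)
    have "\<bar>\<Psi> (u (Suc n)) x - \<Psi> (u n) x\<bar> \<le> (1 / 4 * (1 / 2) ^ n) / 2"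
      unfolding \<Psi>_def
      by (rule gibbs_contraction[OF K c u u Suc]) (simp add: power_le_one)
    then show ?case by (simp add: u_def)
  qed
  have "convergent (\<lambda>n. u n x)" for x
  proof -
    have "summable (\<lambda>n. u (Suc n) x - u n x)"
    proof (rule summable_comparison_test')
      show "summable (\<lambda>n. 1 / 4 * (1 / 2) ^ n :: real)"
        by (intro summable_mult summable_geometric) simp
      show "norm (u (Suc n) x - u n x) \<le> 1 / 4 * (1 / 2) ^ n" if "0 \<le> n" for n
        using step by simp
    qed
    then have "convergent (\<lambda>n. \<Sum>i<n. u (Suc i) x - u i x)" by (simp add: summable_iff_convergent)
    then have "convergent (\<lambda>n. u n x - u 0 x)" 
      by (simp only: sum_lessThan_telescope[of "\<lambda>n. u n x"])
    then show ?thesis by (simp add: u_def)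
  qed
  then obtain v where lim: "\<And>x. (\<lambda>n. u n x) \<longlonglongrightarrow> v x" unfolding convergent_def by metis
  have v: "bounded_Borel (1 / 8) v" by (rule bounded_Borel_limit[OF u lim])
  have "(\<lambda>n. \<Psi> (u n) x) \<longlonglongrightarrow> \<Psi> v x" for x
    unfolding \<Psi>_def by (intro tendsto_mult tendsto_const convolve_gibbs_continuous[OF K u lim])
  moreover have "(\<lambda>n. \<Psi> (u n) x) \<longlonglongrightarrow> v x" for x
    using LIMSEQ_Suc[OF lim, of x] by (simp add: u_def)
  ultimately have "v = \<Psi> v" using LIMSEQ_unique by (intro ext) blast
  with v show ?thesis unfolding \<Psi>_def by blast
qed

text \<open>Repeated contraction halves the a priori distance \<open>1 / 4\<close> arbitrarily
  often.\<close>

lemma gibbs_small_fixed_point_unique: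
  assumes K: "K \<in> borel_measurable borel" "AE x in lborel. \<bar>K x\<bar> \<le> \<kappa>"
    and c: "0 \<le> c" "c * \<kappa> \<le> 1 / 8"
    and u: "bounded_Borel (1 / 8) u" "u = (\<lambda>x. c * convolve K (gibbs \<phi> u) x)"
    and u': "bounded_Borel (1 / 8) u'" "u' = (\<lambda>x. c * convolve K (gibbs \<phi> u') x)"
  shows "u = u'"
proof
  fix x
  have le: "\<bar>u x - u' x\<bar> \<le> 1 / 4 * (1 / 2) ^ n" for n x
  proof (induction n arbitrary: x)
    case 0
    have "\<bar>u x\<bar> \<le> 1 / 8" "\<bar>u' x\<bar> \<le> 1 / 8" using u u' by (auto simp: bounded_Borel_def)
    then have "\<bar>u x - u' x\<bar> \<le> 1 / 4" by linarith
    then show ?case by simp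
  next
    case (Suc n)
    have "\<bar>u x - u' x\<bar> \<le> (1 / 4 * (1 / 2) ^ n) / 2"
      using gibbs_contraction[OF K c u(1) u'(1) Suc, of x] fun_cong[OF u(2), of x] fun_cong[OF u'(2), of x]
      by (simp add: power_le_one)
    then show ?case by simp
  qed
  have lim: "(\<lambda>n. 1 / 4 * (1 / 2) ^ n :: real) \<longlonglongrightarrow> 1 / 4 * 0"
    by (intro tendsto_mult tendsto_const LIMSEQ_realpow_zero) auto
  have "\<bar>u x - u' x\<bar> \<le> 1 / 4 * 0" by (rule LIMSEQ_le_const[OF lim]) (use le in blast)
  then show "u x = u' x" by simp
qed

end


section \<open>Stationary solutions\<close>

lemma confinement_quadratic:
  assumes "0 < \<alpha>" "0 < \<theta>"
  shows "confinement (\<lambda>x. \<alpha> * x\<^sup>2 / (2 * \<theta>))"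
proof
  show "integrable lborel (\<lambda>x::real. exp (- (\<alpha> * x\<^sup>2 / (2 * \<theta>))))"
    using integrable_gaussian(1)[of "\<alpha> / (2 * \<theta>)"] assms by simp
qed measurable

lemma vfp_map_eq_gibbs:
  "vfp_map \<alpha> \<theta> I M K \<sigma> = gibbs (\<lambda>x. \<alpha> * x\<^sup>2 / (2 * \<theta>)) (\<lambda>x. I * M / \<theta> * convolve K \<sigma> x)"
  by (rule ext) (simp only: vfp_map_def gibbs_def)

section \<open>Integrals of product-form densities\<close>

lemma spatial_density_product_form:
  assumes "0 < \<theta>"
  shows "integrable lborel (\<lambda>v. product_form \<theta> M \<sigma> x v)"
    and "spatial_density (product_form \<theta> M \<sigma>) x = M * \<sigma> x"
proof -
  have g: "integrable lborel (\<lambda>v::real. exp (- (v\<^sup>2 / (2 * \<theta>))))"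
    "(LINT v|lborel. exp (- (v\<^sup>2 / (2 * \<theta>)))) = sqrt (2 * pi * \<theta>)"
    using integrable_gaussian[of "1 / (2 * \<theta>)"] assms by (simp_all add: mult_ac)
  have eq: "product_form \<theta> M \<sigma> x v = (M / sqrt (2 * pi * \<theta>) * \<sigma> x) * exp (- (v\<^sup>2 / (2 * \<theta>)))" for v
    by (simp add: product_form_def)
  show "integrable lborel (\<lambda>v. product_form \<theta> M \<sigma> x v)"
    unfolding eq using g(1) by (rule integrable_mult_right)
  show "spatial_density (product_form \<theta> M \<sigma>) x = M * \<sigma> x"
    unfolding spatial_density_def eq integral_mult_right_zero g(2) using assms by simp
qed

lemma product_form_integrable:
  assumes \<theta>: "0 < \<theta>" and M: "0 < M" and \<sigma>: "integrable lborel \<sigma>"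
  shows "integrable lborel (case_prod (product_form \<theta> M \<sigma>))"
    and "mass (product_form \<theta> M \<sigma>) = M * (LINT x|lborel. \<sigma> x)"
proof -
  have [measurable]: "\<sigma> \<in> borel_measurable borel" using \<sigma> by simp
  have norm_eq: "norm (product_form \<theta> M \<sigma> x v) = product_form \<theta> M (\<lambda>x. \<bar>\<sigma> x\<bar>) x v" for x v
    using \<theta> M by (simp add: product_form_def abs_mult)
  have int: "integrable (lborel \<Otimes>\<^sub>M lborel) (case_prod (product_form \<theta> M \<sigma>))"
  proof (rule lborel_pair.Fubini_integrable)
    show "case_prod (product_form \<theta> M \<sigma>) \<in> borel_measurable (lborel \<Otimes>\<^sub>M lborel)"
      unfolding product_form_def by measurable
    have "(LINT v|lborel. norm (case (x, v) of (x, v) \<Rightarrow> product_form \<theta> M \<sigma> x v)) = M * \<bar>\<sigma> x\<bar>" for x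
      using spatial_density_product_form(2)[OF \<theta>, of M "\<lambda>x. \<bar>\<sigma> x\<bar>" x]
      unfolding prod.case norm_eq spatial_density_def .
    then show "integrable lborel (\<lambda>x. LINT v|lborel. norm (case (x, v) of (x, v) \<Rightarrow> product_form \<theta> M \<sigma> x v))"
      using \<sigma> by simp
  qed (use spatial_density_product_form(1)[OF \<theta>] in simp)
  then show "integrable lborel (case_prod (product_form \<theta> M \<sigma>))" by (simp add: lborel_prod)
  show "mass (product_form \<theta> M \<sigma>) = M * (LINT x|lborel. \<sigma> x)"
    using lborel_pair.integral_fst[OF int] spatial_density_product_form(2)[OF \<theta>, of M \<sigma>]
    unfolding mass_def spatial_density_def lborel_prod by simp
qed

text \<open>By Fubini some velocity slice is integrable, and the Maxwellian factor is a nonzero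
  constant on that slice.\<close>

lemma product_form_integrableD:
  assumes \<theta>: "0 < \<theta>" and M: "0 < M" and int: "integrable lborel (case_prod (product_form \<theta> M \<sigma>))"
  shows "integrable lborel \<sigma>"
proof -
  have "integrable (lborel \<Otimes>\<^sub>M lborel) (case_prod (product_form \<theta> M \<sigma>))"
    using int by (simp add: lborel_prod)
  then have "AE v in lborel. integrable lborel (\<lambda>x. product_form \<theta> M \<sigma> x v)"
    by (rule lborel_pair.AE_integrable_snd)
  then obtain v where "integrable lborel (\<lambda>x. product_form \<theta> M \<sigma> x v)"
    using eventually_happens[of _ "ae_filter (lborel :: real measure)"]
    by (auto simp: ae_filter_eq_bot_iff)
  then have "integrable lborel (\<lambda>x. inverse (M / sqrt (2 * pi * \<theta>) * exp (- (v\<^sup>2 / (2 * \<theta>)))) * product_form \<theta> M \<sigma> x v)"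
    by (rule integrable_mult_right)
  moreover have "inverse (M / sqrt (2 * pi * \<theta>) * exp (- (v\<^sup>2 / (2 * \<theta>)))) * product_form \<theta> M \<sigma> x v = \<sigma> x" for x
  proof -
    have "inverse e * (e * s) = s" if "e \<noteq> 0" for e s :: real using that by simp
    then show ?thesis unfolding product_form_def using \<theta> M by simp
  qed
  ultimately show ?thesis by simp
qed

lemma I_thres_bound:
  assumes I: "ereal I < I_thres C \<theta> M K" and K: "Linf_norm K = ereal \<kappa>" "0 \<le> \<kappa>"
    and pos: "0 < I" "0 < M" "0 < \<theta>" "0 < C"
  shows "I * M / \<theta> * \<kappa> \<le> C"
proof (cases "\<kappa> = 0")
  case False
  with K(2) pos have p: "0 < M * \<kappa>" by simp
  then have "I < C * \<theta> / (M * \<kappa>)" using I False pos(2) by (simp add: I_thres_def K(1))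
  then have "I * (M * \<kappa>) < C * \<theta>" using p by (simp add: pos_less_divide_eq)
  then show ?thesis using pos by (simp add: divide_le_eq mult_ac)
qed (use pos in simp)

lemma unique_product_stationary:
  assumes K: "Lp \<infinity> K" and pos: "0 < \<alpha>" "0 < \<theta>" "0 < I" "0 < M"
    and I: "ereal I < I_thres (1 / 8) \<theta> M K"
  shows "\<exists>!f. integrable lborel (case_prod f) \<and> product_stationary \<alpha> \<theta> I M K f"
proof -
  define \<phi> where "\<phi> x = \<alpha> * x\<^sup>2 / (2 * \<theta>)" for x
  define c where "c = I * M / \<theta>"
  interpret confinement \<phi> unfolding \<phi>_def by (rule confinement_quadratic) (use pos in auto)
  have Km: "K \<in> borel_measurable borel" using K by (simp add: Lp_def)
  obtain \<kappa> where \<kappa>: "0 \<le> \<kappa>" "Linf_norm K = ereal \<kappa>" "AE x in lborel. \<bar>K x\<bar> \<le> \<kappa>"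
    using Lp_infinity_AE_bounded[OF K] by blast
  have c: "0 \<le> c" "c * \<kappa> \<le> 1 / 8"
    using I_thres_bound[OF I \<kappa>(2,1)] pos by (auto simp: c_def)
  have map: "vfp_map \<alpha> \<theta> I M K \<sigma> = gibbs \<phi> (\<lambda>x. c * convolve K \<sigma> x)" for \<sigma>
    unfolding vfp_map_eq_gibbs c_def \<phi>_def ..
  obtain u where u: "bounded_Borel (1 / 8) u" "u = (\<lambda>x. c * convolve K (gibbs \<phi> u) x)"
    using gibbs_small_fixed_point_exists[OF Km \<kappa>(3) c] by blast
  show ?thesis
  proof (rule ex1I[of _ "product_form \<theta> M (gibbs \<phi> u)"])
    show "integrable lborel (case_prod (product_form \<theta> M (gibbs \<phi> u))) \<and>
        product_stationary \<alpha> \<theta> I M K (product_form \<theta> M (gibbs \<phi> u))"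
      using product_form_integrable(1)[OF pos(2,4) gibbs_density(2)[OF u(1)]] u(2)
      unfolding product_stationary_def map by metis
  next
    fix f assume "integrable lborel (case_prod f) \<and> product_stationary \<alpha> \<theta> I M K f"
    then obtain \<sigma> where int: "integrable lborel (case_prod f)"
      and f: "f = product_form \<theta> M \<sigma>" and \<sigma>: "\<sigma> = gibbs \<phi> (\<lambda>x. c * convolve K \<sigma> x)"
      unfolding product_stationary_def map by blast
    have i: "integrable lborel \<sigma>" using product_form_integrableD[OF pos(2,4)] int f by simp
    define u' where "u' x = c * convolve K \<sigma> x" for x
    have \<sigma>': "\<sigma> = gibbs \<phi> u'" using \<sigma> unfolding u'_def[abs_def] .
    \<comment> \<open>An arbitrary integrable fixed point first yields only a bound that depends on
      its L1 norm. Being a Gibbs density of a bounded potential, it then has norm 1, and the bound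
      improves to \<open>1 / 8\<close>.\<close>
    have "bounded_Borel (c * (\<kappa> * (LINT x|lborel. \<bar>\<sigma> x\<bar>))) u'"
      unfolding bounded_Borel_def
    proof (intro conjI allI)
      have "\<sigma> \<in> borel_measurable borel" using i by simp
      then have "convolve K \<sigma> \<in> borel_measurable borel" using Km by measurable
      then show "u' \<in> borel_measurable borel" unfolding u'_def by measurable
      show "\<bar>u' x\<bar> \<le> c * (\<kappa> * (LINT x|lborel. \<bar>\<sigma> x\<bar>))" for x
        using mult_left_mono[OF convolve_bound(2)[OF Km \<kappa>(3) i] c(1)] c(1)
        by (simp add: u'_def abs_mult)
    qed
    from bounded_Borel_convolve_gibbs[OF Km \<kappa>(3) this c]
    have "bounded_Borel (1 / 8) u'" unfolding \<sigma>'[symmetric] u'_def[symmetric] .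
    moreover have "u' = (\<lambda>x. c * convolve K (gibbs \<phi> u') x)"
      unfolding \<sigma>'[symmetric] by (rule ext) (rule u'_def)
    ultimately have "u' = u"
      using gibbs_small_fixed_point_unique[OF Km \<kappa>(3) c] u by blast
    then show "f = product_form \<theta> M (gibbs \<phi> u)" using f \<sigma>' by simp
  qed
qed

text \<open>The Maxwellian annihilates the velocity flux
  \<open>v * f + \<theta> * \<partial>_v f\<close>. What remains is the balance of transport and
  force, and the assumed formula for the derivative of \<open>\<sigma>\<close> is that
  balance.\<close>

lemma product_form_stationary:
  assumes \<theta>: "0 < \<theta>" and wd: "has_weak_derivative K K'"
    and int: "\<And>x. integrable lborel (\<lambda>y. K' (x - y) * \<sigma> y)"
    and \<sigma>': "\<And>x. (\<sigma> has_real_derivative (- (\<alpha> / \<theta>) * x + - (I * M / \<theta>) * convolve K' \<sigma> x) * \<sigma> x) (at x)"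
  shows "vfp_stationary \<alpha> \<nu> \<theta> I K (product_form \<theta> M \<sigma>)"
proof -
  let ?f = "product_form \<theta> M \<sigma>"
  have rho: "spatial_density ?f = (\<lambda>y. M * \<sigma> y)"
    using spatial_density_product_form(2)[OF \<theta>] by auto
  have int': "integrable lborel (\<lambda>y. K' (x - y) * (M * \<sigma> y))" for x
    using integrable_mult_right[OF int[of x], of M] by (simp add: mult_ac)
  have conv: "convolve K' (\<lambda>y. M * \<sigma> y) x = M * convolve K' \<sigma> x" for x
    unfolding convolve_def integral_mult_right_zero[symmetric] by (simp add: mult_ac)
  have dx: "((\<lambda>y. ?f y v) has_real_derivative
      (- (\<alpha> / \<theta>) * x + - (I * M / \<theta>) * convolve K' \<sigma> x) * ?f x v) (at x)" for x v
    unfolding product_form_def by (rule DERIV_cong[OF DERIV_cmult[OF \<sigma>']]) simp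
  have dv: "((\<lambda>w. ?f x w) has_real_derivative - (v / \<theta>) * ?f x v) (at v)" for x v
    unfolding product_form_def by (rule derivative_eq_intros refl | use \<theta> in simp)+
  have dv': "deriv (\<lambda>w. ?f x w) = (\<lambda>v. - (v / \<theta>) * ?f x v)" for x
    by (rule ext) (rule DERIV_imp_deriv[OF dv])
  have dvv: "(\<lambda>v. - (v / \<theta>) * ?f x v) field_differentiable at v" for x v
  proof -
    have "((\<lambda>v. - (v / \<theta>) * ?f x v) has_real_derivative
        - (1 / \<theta>) * ?f x v + - (v / \<theta>) * (- (v / \<theta>) * ?f x v)) (at v)"
      by (rule DERIV_cong[OF DERIV_mult[OF _ dv]])
         (use \<theta> in \<open>auto intro!: derivative_eq_intros\<close>)
    then show ?thesis by (auto simp: field_differentiable_def)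
  qed
  have flux: "(\<lambda>w. w * ?f x w + \<theta> * (- (w / \<theta>) * ?f x w)) = (\<lambda>_. 0)" for x
    using \<theta> by auto
  have pde: "v * deriv (\<lambda>y. ?f y v) x
      + (- I * convolve K' (\<lambda>y. M * \<sigma> y) x - \<alpha> * x) * (- (v / \<theta>) * ?f x v) = 0" for x v
    unfolding DERIV_imp_deriv[OF dx] conv using \<theta> by (simp add: field_simps)
  have fd: "(\<lambda>y. ?f y v) field_differentiable at x" "(\<lambda>w. ?f x w) field_differentiable at v" for x v
    using dx dv unfolding field_differentiable_def by blast+
  show ?thesis
    unfolding vfp_stationary_def vfp_solution_def Let_def rho dv' flux
    by (intro exI[of _ K'] conjI allI impI wd int' fd dvv spatial_density_product_form(1)[OF \<theta>])
       (simp_all only: field_differentiable_const deriv_const pde add_0_left mult_zero_right)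
qed

lemma convolve_cong_AE:
  assumes [measurable]: "K \<in> borel_measurable borel" "G \<in> borel_measurable borel" "\<sigma> \<in> borel_measurable borel"
    and ae: "AE x in lborel. K x = G x"
  shows "convolve K \<sigma> x = convolve G \<sigma> x"
  unfolding convolve_def
proof (rule integral_cong_AE)
  show "AE y in lborel. K (x - y) * \<sigma> y = G (x - y) * \<sigma> y"
    using AE_reflect[OF ae, of x] by eventually_elim simp
qed measurable

text \<open>The bootstrap: level \<open>n\<close> of \<open>\<sigma>\<close> gives level
  \<open>n\<close> of the class-0 factor in its derivative, hence level \<open>n + 1\<close> of
  \<open>\<sigma>\<close>. The derivative formula is assumed only conditionally, since justifying it
  requires continuity of \<open>K' * \<sigma>\<close>, which the base level provides.\<close>

lemma gibbs_C_gauss: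
  assumes \<alpha>: "0 < \<alpha>" and \<theta>: "0 < \<theta>" and K': "L1_plus_Linf K' k' B'"
    and u: "bounded_Borel b u" "continuous_on UNIV u"
    and \<sigma>: "\<sigma> = gibbs (\<lambda>x. \<alpha> * x\<^sup>2 / (2 * \<theta>)) u"
    and \<sigma>': "C_gauss (\<alpha> / \<theta>) 0 \<sigma> \<Longrightarrow> \<forall>x. (\<sigma> has_real_derivative (- (\<alpha> / \<theta>) * x + - c * convolve K' \<sigma> x) * \<sigma> x) (at x)"
  shows "C_gauss (\<alpha> / \<theta>) n \<sigma>"
proof -
  interpret confinement "\<lambda>x. \<alpha> * x\<^sup>2 / (2 * \<theta>)" by (rule confinement_quadratic[OF \<alpha> \<theta>])
  define A where "A = exp (2 * b) / (LINT y|lborel. exp (- (\<alpha> * y\<^sup>2 / (2 * \<theta>))))"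
  have base: "C_gauss (\<alpha> / \<theta>) 0 \<sigma>"
  proof -
    have "continuous_on UNIV \<sigma>"
      unfolding \<sigma> gibbs_def using gibbs_weight(4)[OF u(1)] u(2) \<theta>
      by (intro continuous_intros) auto
    moreover have "gauss_bounded (\<alpha> / \<theta>) \<sigma>"
      unfolding gauss_bounded_def
    proof (intro allI impI exI)
      fix \<beta> x assume \<beta>: "\<beta> < \<alpha> / \<theta>"
      have A: "0 \<le> A" unfolding A_def by simp
      have "\<bar>\<sigma> x\<bar> \<le> A * exp (- (\<alpha> * x\<^sup>2 / (2 * \<theta>)))"
        unfolding \<sigma> A_def using gibbs_le[OF u(1), of x] gibbs_density(1)[OF u(1), of x] by simp
      also have "\<dots> \<le> A * exp (- (\<beta> * x\<^sup>2 / 2))"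
        using mult_right_mono[OF less_imp_le[OF \<beta>], of "x\<^sup>2"] A by (intro mult_left_mono) auto
      finally show "\<bar>\<sigma> x\<bar> \<le> A * exp (- (\<beta> * x\<^sup>2 / 2))" .
    qed
    ultimately show ?thesis by simp
  qed
  show ?thesis
  proof (induction n)
    case (Suc n)
    have "C_gauss 0 n (\<lambda>x. - (\<alpha> / \<theta>) * x + - c * convolve K' \<sigma> x)"
      using convolve_C_gauss[OF K' _ Suc] \<alpha> \<theta>
      by (intro C_gauss_add C_gauss_mult C_gauss_const C_gauss_ident) auto
    from C_gauss_mult[OF this Suc] \<sigma>'[OF base]
    have "\<exists>g'. (\<forall>x. (\<sigma> has_real_derivative g' x) (at x)) \<and> C_gauss (\<alpha> / \<theta>) n g'"
      by (intro exI[of _ "\<lambda>x. (- (\<alpha> / \<theta>) * x + - c * convolve K' \<sigma> x) * \<sigma> x"] conjI)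
    then show ?case unfolding C_gauss.simps(2) using C_gauss_imp[OF Suc] by blast
  qed (rule base)
qed

text \<open>The role of \<open>K'\<close> is twofold: through the L1 + Linf bound it gives the
  Lipschitz constant needed for compactness, and afterwards it appears as the force in the
  equation.\<close>

lemma stationary_solution_exists:
  assumes pos: "0 < \<alpha>" "0 < \<theta>" "0 < I" "0 < M" and p: "1 \<le> p" and W: "W1p p K"
  shows "\<exists>\<sigma>. vfp_stationary \<alpha> \<nu> \<theta> I K (product_form \<theta> M \<sigma>) \<and> integrable lborel \<sigma> \<and>
    (LINT x|lborel. \<sigma> x) = 1 \<and> \<sigma> = vfp_map \<alpha> \<theta> I M K \<sigma> \<and> (\<forall>n. C_gauss (\<alpha> / \<theta>) n \<sigma>)"
proof -
  define \<phi> where "\<phi> x = \<alpha> * x\<^sup>2 / (2 * \<theta>)" for x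
  define c where "c = I * M / \<theta>"
  have c: "0 < c" using pos by (simp add: c_def)
  have r: "0 < \<alpha> / \<theta>" using pos by simp
  interpret confinement \<phi> unfolding \<phi>_def by (rule confinement_quadratic) (use pos in auto)
  obtain K' k B k' B' where wd: "has_weak_derivative K K'"
    and K: "L1_plus_Linf K k B" and K': "L1_plus_Linf K' k' B'"
    using W Lp_imp_L1_plus_Linf[OF p] unfolding W1p_def by metis
  have Km: "K \<in> borel_measurable borel" "K' \<in> borel_measurable borel"
    using K K' by (auto simp: L1_plus_Linf_def)
  have loc: "locally_integrable K'" using wd by (simp add: has_weak_derivative_def)
  obtain G where G: "continuous_on UNIV G" "\<And>a x. a \<le> x \<Longrightarrow> G x - G a = (LINT s:{a..x}|lborel. K' s)"
    and ae: "AE x in lborel. K x = G x"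
    using weak_derivative_representation[OF wd K K'] by blast
  have Gm: "G \<in> borel_measurable borel" using G(1) by (rule borel_measurable_continuous_onI)
  obtain \<kappa> where G\<kappa>: "\<And>x. \<bar>G x\<bar> \<le> \<kappa>"
    using weak_derivative_representation_bounded[OF K K' loc G(2) ae] by blast
  have \<kappa>: "AE x in lborel. \<bar>K x\<bar> \<le> \<kappa>" using ae by eventually_elim (simp add: G\<kappa>)
  have \<kappa>0: "0 \<le> \<kappa>" using order_trans[OF abs_ge_zero G\<kappa>] .
  \<comment> \<open>The summand 1 keeps the radius positive when the kernel vanishes; the cube
    rescaling divides by \<open>b\<close>.\<close>
  define b where "b = c * \<kappa> + 1"
  have b: "0 < b" "c * \<kappa> \<le> b" using c \<kappa>0 by (auto simp: b_def add_nonneg_pos)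
  \<comment> \<open>\<open>A\<close> bounds every Gibbs density of the ball, since the quadratic
    weight is at most 1; \<open>L\<close> is the resulting bound for its convolution with
    \<open>K'\<close>.\<close>
  define A where "A = exp (2 * b) / (LINT y|lborel. exp (- \<phi> y))"
  define L where "L = A * (LINT y|lborel. k' y) + B'"
  have \<sigma>A: "\<bar>gibbs \<phi> u x\<bar> \<le> A" if u: "bounded_Borel b u" for u x
  proof -
    have "0 \<le> A" unfolding A_def by simp
    then have "A * exp (- \<phi> x) \<le> A * 1"
      using pos by (intro mult_left_mono) (auto simp: \<phi>_def)
    then show ?thesis
      using gibbs_le[OF u, of x] gibbs_density(1)[OF u, of x] by (simp add: A_def)
  qed
  \<comment> \<open>Convolution ignores null sets, so the absolutely continuous representative may
    replace the kernel wherever increments are computed.\<close>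
  have KG: "convolve K (gibbs \<phi> u) = convolve G (gibbs \<phi> u)" if u: "bounded_Borel b u" for u
    using gibbs_density(2)[OF u] by (intro ext convolve_cong_AE Km Gm ae) auto
  note convK' = L1_plus_Linf_convolve[OF K' gibbs_density(2) \<sigma>A]
  have bd: "(LINT y|lborel. \<bar>K' (x - y) * gibbs \<phi> u y\<bar>) \<le> L" "\<bar>convolve K' (gibbs \<phi> u) x\<bar> \<le> L"
    if u: "bounded_Borel b u" for u x
    using convK'(2,3)[OF u u, of x] gibbs_density(4)[OF u] by (simp_all add: L_def)
  have inc: "\<bar>convolve K (gibbs \<phi> u) x - convolve K (gibbs \<phi> u) a\<bar> \<le> L * (x - a)"
    if u: "bounded_Borel b u" and ax: "a \<le> x" for u a x
  proof -
    have m: "gibbs \<phi> u \<in> borel_measurable borel" using gibbs_density(2)[OF u] by simp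
    have Gint: "integrable lborel (\<lambda>y. G (x - y) * gibbs \<phi> u y)" for x
      by (rule convolve_bound(1)[OF Gm _ gibbs_density(2)[OF u]]) (use G\<kappa> in auto)
    note ci = convolve_increment[OF m Km(2) G(2) convK'(1)[OF u u] bd(1)[OF u] Gint ax]
    have "\<bar>LINT s:{a..x}|lborel. convolve K' (gibbs \<phi> u) s\<bar>
        \<le> (LINT s|lborel. \<bar>indicator {a..x} s * convolve K' (gibbs \<phi> u) s\<bar>)"
      unfolding set_lebesgue_integral_def by (simp add: integral_abs_bound)
    also have "\<dots> \<le> (LINT s|lborel. L * indicator {a..x} s)"
      using ci(2) bd(2)[OF u] ax unfolding set_integrable_def
      by (intro integral_mono integrable_abs integrable_mult_right integrable_real_indicator)
         (auto simp: indicator_def)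
    also have "\<dots> = L * (x - a)" using ax by simp
    finally show ?thesis using ci(1) KG[OF u] by simp
  qed
  have lip: "\<bar>c * convolve K (gibbs \<phi> u) x - c * convolve K (gibbs \<phi> u) y\<bar> \<le> (c * L) * \<bar>x - y\<bar>"
    if u: "bounded_Borel b u" for u x y
  proof -
    have "\<bar>convolve K (gibbs \<phi> u) x - convolve K (gibbs \<phi> u) y\<bar> \<le> L * \<bar>x - y\<bar>"
      using inc[OF u, of x y] inc[OF u, of y x] by (cases "x \<le> y") (auto simp: abs_minus_commute)
    from mult_left_mono[OF this, of c] show ?thesis
      using c by (simp add: right_diff_distrib[symmetric] abs_mult mult.assoc)
  qed
  obtain u where u: "bounded_Borel b u" "u = (\<lambda>x. c * convolve K (gibbs \<phi> u) x)"
    using gibbs_fixed_point_exists[OF Km(1) \<kappa> less_imp_le[OF c] b(2,1) lip] by blast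
  define \<sigma> where "\<sigma> = gibbs \<phi> u"
  have u\<sigma>: "u x = c * convolve K \<sigma> x" for x using fun_cong[OF u(2), of x] by (simp add: \<sigma>_def)
  have int: "integrable lborel \<sigma>" and \<sigma>m: "\<sigma> \<in> borel_measurable borel"
    using gibbs_density(2)[OF u(1)] by (auto simp: \<sigma>_def)
  have cont_u: "continuous_on UNIV u"
  proof -
    have le: "\<bar>u x - u y\<bar> \<le> (c * L) * \<bar>x - y\<bar>" for x y
      unfolding u\<sigma>[of x] u\<sigma>[of y] \<sigma>_def by (rule lip[OF u(1)])
    have "0 \<le> c * L" using order_trans[OF abs_ge_zero le[of 0 1]] by simp
    with le have "(c * L)-lipschitz_on UNIV u" by (intro lipschitz_onI) (simp_all only: dist_real_def)
    then show ?thesis by (rule lipschitz_on_continuous_on)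
  qed
  have der: "(\<sigma> has_real_derivative (- (\<alpha> / \<theta>) * x + - c * convolve K' \<sigma> x) * \<sigma> x) (at x)"
    if C: "C_gauss (\<alpha> / \<theta>) 0 \<sigma>" for x
  proof -
    have conv: "convolve K \<sigma> = convolve G \<sigma>" unfolding \<sigma>_def by (rule KG[OF u(1)])
    have Gint: "integrable lborel (\<lambda>y. G (x - y) * \<sigma> y)" for x
      by (rule convolve_bound(1)[OF Gm _ int]) (use G\<kappa> in auto)
    have "(convolve G \<sigma> has_real_derivative convolve K' \<sigma> x) (at x)"
      using convolve_has_derivative[OF \<sigma>m Km(2) G(2) convK'(1)[OF u(1) u(1), folded \<sigma>_def]
          bd(1)[OF u(1), folded \<sigma>_def] Gint convolve_continuous[OF K' _ _ r]] C by simp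
    then have "(u has_real_derivative c * convolve K' \<sigma> x) (at x)"
      unfolding u\<sigma>[abs_def] conv by (rule DERIV_cmult)
    moreover have "(\<phi> has_real_derivative \<alpha> / \<theta> * x) (at x)"
      unfolding \<phi>_def[abs_def] using pos by (auto intro!: derivative_eq_intros simp: field_simps)
    ultimately have "((\<lambda>x. exp (- \<phi> x - u x)) has_real_derivative
        exp (- \<phi> x - u x) * (- (\<alpha> / \<theta> * x) - c * convolve K' \<sigma> x)) (at x)"
      by (intro DERIV_fun_exp DERIV_diff DERIV_minus)
    from DERIV_cdivide[OF this, of "LINT y|lborel. exp (- \<phi> y - u y)"]
    show ?thesis unfolding \<sigma>_def gibbs_def[of \<phi> u, abs_def]
      by (rule DERIV_cong) simp
  qed
  have smooth: "C_gauss (\<alpha> / \<theta>) n \<sigma>" for n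
    using gibbs_C_gauss[OF pos(1,2) K' u(1) cont_u, of \<sigma> c n] der
    unfolding \<sigma>_def \<phi>_def[abs_def] by blast
  have "vfp_stationary \<alpha> \<nu> \<theta> I K (product_form \<theta> M \<sigma>)"
    using der smooth[of 0] convK'(1)[OF u(1) u(1), folded \<sigma>_def]
    unfolding c_def by (intro product_form_stationary[OF pos(2) wd]) auto
  moreover have "\<sigma> = vfp_map \<alpha> \<theta> I M K \<sigma>"
    using u\<sigma>[abs_def] unfolding vfp_map_eq_gibbs c_def[symmetric] \<phi>_def[abs_def, symmetric]
    by (simp add: \<sigma>_def)
  ultimately show ?thesis
    using int smooth gibbs_density(3)[OF u(1)] unfolding \<sigma>_def[symmetric] by blast
qed

lemma C_gauss_deriv_bounded:
  assumes "\<And>n. C_gauss r n g" "\<beta> < r"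
  shows "bdd_above (range (\<lambda>x. \<bar>(deriv ^^ n) g x * exp (\<beta> * x\<^sup>2 / 2)\<bar>))"
proof -
  have "gauss_bounded r ((deriv ^^ n) g)"
    using C_gauss_higher_deriv[OF assms(1), of 0 n] by auto
  then obtain C where C: "\<And>x. \<bar>(deriv ^^ n) g x\<bar> \<le> C * exp (- (\<beta> * x\<^sup>2 / 2))"
    using assms(2) unfolding gauss_bounded_def by blast
  have "\<bar>(deriv ^^ n) g x * exp (\<beta> * x\<^sup>2 / 2)\<bar> \<le> C" for x
    using mult_right_mono[OF C[of x], of "exp (\<beta> * x\<^sup>2 / 2)"]
    by (simp add: abs_mult mult.assoc exp_add[symmetric])
  then show ?thesis by (auto intro: bdd_aboveI[of _ C])
qed

theorem theorem1p2:
  shows "(\<forall>(\<alpha> :: real) (\<nu> :: real) (\<theta> :: real) (I :: real) (M :: real) (p :: ennreal) (K :: real \<Rightarrow> real).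
            \<alpha> > 0 \<and> \<nu> > 0 \<and> \<theta> > 0 \<and> I > 0 \<and> M > 0 \<and> 1 \<le> p \<and> W1p p K \<longrightarrow>
            (\<exists>(f :: real \<Rightarrow> real \<Rightarrow> real) (\<sigma> :: real \<Rightarrow> real).
               f = product_form \<theta> M \<sigma> \<and>
               vfp_stationary \<alpha> \<nu> \<theta> I K f \<and>
               integrable lborel (case_prod f) \<and> mass f = M \<and>
               integrable lborel \<sigma> \<and> (LINT x|lborel. \<sigma> x) = 1 \<and>
               \<sigma> = vfp_map \<alpha> \<theta> I M K \<sigma> \<and>
               smooth \<sigma> \<and>
               (\<forall>(\<beta> :: real) (n :: nat). 0 < \<beta> \<and> \<beta> < \<alpha> / \<theta> \<longrightarrow>
                  bdd_above (range (\<lambda>x. \<bar>(deriv ^^ n) \<sigma> x * exp (\<beta> * x\<^sup>2 / 2)\<bar>)))))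
       \<and> (\<forall>K :: real \<Rightarrow> real. Lp \<infinity> K \<longrightarrow>
            (\<exists>C>0. \<forall>(\<alpha> :: real) (\<nu> :: real) (\<theta> :: real) (I :: real) (M :: real).
               \<alpha> > 0 \<and> \<nu> > 0 \<and> \<theta> > 0 \<and> I > 0 \<and> M > 0 \<and> ereal I < I_thres C \<theta> M K \<longrightarrow>
               (\<exists>!f :: real \<Rightarrow> real \<Rightarrow> real.
                  integrable lborel (case_prod f) \<and> product_stationary \<alpha> \<theta> I M K f)))"
proof (intro conjI allI impI)
  fix \<alpha> \<nu> \<theta> I M :: real and p K
  assume A: "\<alpha> > 0 \<and> \<nu> > 0 \<and> \<theta> > 0 \<and> I > 0 \<and> M > 0 \<and> 1 \<le> p \<and> W1p p K"
  then obtain \<sigma> where \<sigma>: "vfp_stationary \<alpha> \<nu> \<theta> I K (product_form \<theta> M \<sigma>)" "integrable lborel \<sigma>"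
    "(LINT x|lborel. \<sigma> x) = 1" "\<sigma> = vfp_map \<alpha> \<theta> I M K \<sigma>" "\<And>n. C_gauss (\<alpha> / \<theta>) n \<sigma>"
    using stationary_solution_exists by metis
  have "integrable lborel (case_prod (product_form \<theta> M \<sigma>))" "mass (product_form \<theta> M \<sigma>) = M"
    using product_form_integrable[OF _ _ \<sigma>(2)] \<sigma>(3) A by auto
  then show "\<exists>(f :: real \<Rightarrow> real \<Rightarrow> real) (\<sigma> :: real \<Rightarrow> real).
               f = product_form \<theta> M \<sigma> \<and>
               vfp_stationary \<alpha> \<nu> \<theta> I K f \<and>
               integrable lborel (case_prod f) \<and> mass f = M \<and>
               integrable lborel \<sigma> \<and> (LINT x|lborel. \<sigma> x) = 1 \<and>
               \<sigma> = vfp_map \<alpha> \<theta> I M K \<sigma> \<and>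
               smooth \<sigma> \<and>
               (\<forall>(\<beta> :: real) (n :: nat). 0 < \<beta> \<and> \<beta> < \<alpha> / \<theta> \<longrightarrow>
                  bdd_above (range (\<lambda>x. \<bar>(deriv ^^ n) \<sigma> x * exp (\<beta> * x\<^sup>2 / 2)\<bar>)))"
    using \<sigma> C_gauss_smooth[OF \<sigma>(5)] C_gauss_deriv_bounded[OF \<sigma>(5)]
    by (intro exI[of _ "product_form \<theta> M \<sigma>"] exI[of _ \<sigma>] conjI) auto
next
  fix K :: "real \<Rightarrow> real" assume "Lp \<infinity> K"
  then show "\<exists>C>0. \<forall>(\<alpha> :: real) (\<nu> :: real) (\<theta> :: real) (I :: real) (M :: real).
               \<alpha> > 0 \<and> \<nu> > 0 \<and> \<theta> > 0 \<and> I > 0 \<and> M > 0 \<and> ereal I < I_thres C \<theta> M K \<longrightarrow>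
               (\<exists>!f :: real \<Rightarrow> real \<Rightarrow> real.
                  integrable lborel (case_prod f) \<and> product_stationary \<alpha> \<theta> I M K f)"
    \<comment> \<open>The contraction constant \<open>1 / 8\<close> serves every bounded
      kernel.\<close>
    using unique_product_stationary by (intro exI[of _ "1 / 8"]) simp
qed

end
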